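(* Let $\varphi\in\mathcal O(\mathbb D^2,\mathbb D)$ extend to a $\mathcal C^3$-smooth function on $\overline{\mathbb D^2}$. Assume there exists $\xi\in\mathbb T^2$ with $\varphi(\xi)\in\mathbb T$ such that $\varphi$ is truly two-dimensional at $\xi$ of order $2$. Then there exist a neighbourhood $\mathcal U$ of $\xi$ and $C>0$ such that for all $\beta\in(-1,0]$, all $\eta\in\mathbb T$ and all $\delta>0$, $$V_\beta\big(\{z\in\mathbb D^2\cap\mathcal U:\ |\varphi(z)-\eta|<\delta\}\big)\le C\delta^{2+\beta+\frac12}.$$
   Context: $dA$ is the normalized area measure on $\mathbb D$; $dA_\beta(z)=(\beta+1)(1-|z|^2)^\beta dA(z)$; $dV_\beta=dA_\beta(z_1)dA_\beta(z_2)$. For $\varphi\in\mathcal O(\mathbb D^2,\mathbb D)\cap\mathcal C^2(\overline{\mathbb D^2})$ and $\xi=(e^{i\alpha_1},e^{i\alpha_2})\in\mathbb T^2$ with $\varphi(\xi)\in\mathbb T$, set $\psi(\theta)=\overline{\varphi(\xi)}\varphi(e^{i(\alpha_1+\theta_1)},e^{i(\alpha_2+\theta_2)})$, $\theta\in\mathbb R^2$. We say $\varphi$ is truly two-dimensional at $\xi$ of order $2$ if, writing $\mathrm{Re}\,\psi(\theta)=1-Q(\theta)+o(|\theta|^2)$ with $Q$ a real quadratic form, $Q$ has signature $(2,0)$ (i.e. is positive definite). *)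

theory Defs
  imports "HOL-Analysis.Analysis" "HOL-Library.Landau_Symbols"
begin

definition bidisc :: "(complex \<times> complex) set" where
  "bidisc = ball 0 1 \<times> ball 0 1"

definition closed_bidisc :: "(complex \<times> complex) set" where
  "closed_bidisc = cball 0 1 \<times> cball 0 1"

definition torus2 :: "(complex \<times> complex) set" where
  "torus2 = sphere 0 1 \<times> sphere 0 1"

definition holomorphic2_on :: "(complex \<times> complex \<Rightarrow> complex) \<Rightarrow> (complex \<times> complex) set \<Rightarrow> bool" where
  "holomorphic2_on f S \<longleftrightarrow>
     (\<forall>z\<in>S. \<exists>c1 c2. (f has_derivative (\<lambda>h. c1 * fst h + c2 * snd h)) (at z))"

fun Ck_on :: "nat \<Rightarrow> 'a::euclidean_space set \<Rightarrow> ('a \<Rightarrow> 'b::real_normed_vector) \<Rightarrow> bool" where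
  "Ck_on 0 S f = continuous_on S f"
| "Ck_on (Suc k) S f =
     (continuous_on S f \<and> (\<forall>x\<in>S. f differentiable (at x)) \<and>
      (\<forall>v. Ck_on k S (\<lambda>x. frechet_derivative f (at x) v)))"

definition Ck_on_closed_bidisc :: "nat \<Rightarrow> (complex \<times> complex \<Rightarrow> complex) \<Rightarrow> bool" where
  "Ck_on_closed_bidisc k f \<longleftrightarrow> (\<exists>S. open S \<and> closed_bidisc \<subseteq> S \<and> Ck_on k S f)"

text \<open>psi(theta) = conj(phi xi) * phi(e^{i(alpha1+theta1)}, e^{i(alpha2+theta2)}),
  where xi = (e^{i alpha1}, e^{i alpha2}).\<close>
definition psi_at :: "(complex \<times> complex \<Rightarrow> complex) \<Rightarrow> complex \<times> complex \<Rightarrow> real \<times> real \<Rightarrow> complex" where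
  "psi_at f \<xi> \<theta> = cnj (f \<xi>) * f (fst \<xi> * cis (fst \<theta>), snd \<xi> * cis (snd \<theta>))"

definition truly_two_dim_order2 :: "(complex \<times> complex \<Rightarrow> complex) \<Rightarrow> complex \<times> complex \<Rightarrow> bool" where
  "truly_two_dim_order2 f \<xi> \<longleftrightarrow>
     \<xi> \<in> torus2 \<and> f \<xi> \<in> sphere 0 1 \<and>
     (\<exists>a b c :: real.
        (\<forall>\<theta>::real\<times>real. \<theta> \<noteq> 0 \<longrightarrow> a * (fst \<theta>)\<^sup>2 + 2 * b * fst \<theta> * snd \<theta> + c * (snd \<theta>)\<^sup>2 > 0) \<and>
        (\<lambda>\<theta>::real\<times>real. Re (psi_at f \<xi> \<theta>) - (1 - (a * (fst \<theta>)\<^sup>2 + 2 * b * fst \<theta> * snd \<theta> + c * (snd \<theta>)\<^sup>2)))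
          \<in> o[at 0](\<lambda>\<theta>. (norm \<theta>)\<^sup>2))"

definition dA_beta :: "real \<Rightarrow> complex measure" where
  "dA_beta \<beta> = density lborel
     (\<lambda>z. ennreal (indicator (ball 0 1) z * ((\<beta> + 1) * (1 - (cmod z)\<^sup>2) powr \<beta> / pi)))"

definition V_beta :: "real \<Rightarrow> (complex \<times> complex) measure" where
  "V_beta \<beta> = dA_beta \<beta> \<Otimes>\<^sub>M dA_beta \<beta>"

end

(* With F(theta) = phi(xi1 e^(i theta1), xi2 e^(i theta2)), the problem reduces to the torus:
   Schwarz-Pick together with |phi(0, xi2)| < 1 yields the Hopf type bound 1 - |phi(z)| >= c (1 - |z_j|)
   near xi. Hence a point z with |phi(z) - eta| < delta lies within O(delta) of the torus, and
   d_1 F(0) = i s phi(xi) with s > 0. Therefore the real part of i conj(d_1 F(p)) F has no theta1-term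
   to first order at p, and is strictly concave near 0 because Q is positive definite. Among three
   points of {|F - eta| < delta}, the theta2-gap from the middle one to one of the others is then
   O(sqrt delta), so the theta2-projection lies in two intervals of length O(sqrt delta), while
   theta2-slices have length O(delta). So the set is covered by O(1 / sqrt delta) products of two
   Carleson boxes of size delta, each box having measure O(delta^(2 + beta)), uniformly in eta and beta.
   The total is even O(delta^(7/2 + 2 beta)). *)

theory Submission
  imports Defs "HOL-Complex_Analysis.Riemann_Mapping"
begin

text \<open>The obstacle is that \<eta> is arbitrary, so no expansion at a single point describes
  the sublevel set. Only differences of values of F at two of its points are estimated, and \<eta>
  drops out. The functional w |-> Re(i conj(d_1 F(p)) w) has to move with p, since a fixed one is
  sure to annihilate d_1 F at one point only. At p = 0 it equals s Re(conj(phi(xi)) w), with Hessian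
  -2 s Q along F; compactness keeps strict concavity when the point choosing the functional and the
  point carrying the Hessian vary independently near 0. Positive definiteness of Q acts twice: in
  this concavity, and in making the slices through xi non-constant, which is what excludes |phi(0,
  xi2)| = 1. That d_1 F(0) is a multiple i s of phi(xi) combines the missing linear term of Re psi
  (s is real) with the Hopf bound on the radius (s > 0). Uniformity in \<beta> rests on the factor
  \<beta> + 1 of the density cancelling the 1 / (\<beta> + 1) produced by integrating a \<beta>-th
  power up to the circle.\<close>

subsection \<open>Boundary behaviour of holomorphic functions\<close>

text \<open>Schwarz's lemma for \<open>f\<close> followed by the disc automorphism sending
  \<open>f 0\<close> to 0. The denominator is cleared so that the estimate survives a boundary limit
  in which \<open>1 - cnj (f 0) * f z\<close> may tend to 0.\<close>

lemma Schwarz_Pick_at_0: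
  assumes holf: "f holomorphic_on ball 0 1" and fim: "f ` ball 0 1 \<subseteq> ball 0 1"
    and z: "z \<in> ball (0::complex) 1"
  shows "cmod (f z - f 0) \<le> cmod z * cmod (1 - cnj (f 0) * f z)"
proof -
  have lt1: "cmod (f w) < 1" if "cmod w < 1" for w
    using fim that by (auto simp: image_subset_iff)
  define g where "g = Moebius_function 0 (f 0) \<circ> f"
  have "cmod (g z) \<le> cmod z"
  proof (rule Schwarz_Lemma(1))
    show "g holomorphic_on ball 0 1"
      unfolding g_def
      by (rule holomorphic_on_compose_gen[OF holf Moebius_function_holomorphic fim]) (simp add: lt1)
    show "g 0 = 0"
      by (simp add: g_def Moebius_function_eq_zero)
    show "cmod (g w) < 1" if "cmod w < 1" for w
      unfolding g_def o_def by (rule Moebius_function_norm_lt_1) (auto simp: lt1 that)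
    show "cmod z < 1"
      using z by simp
  qed
  moreover have "cmod (cnj (f 0) * f z) < 1"
    unfolding norm_mult complex_mod_cnj
    by (rule order.strict_trans1[OF mult_left_le_one_le]) (use lt1[of 0] lt1[of z] z in auto)
  then have "1 - cnj (f 0) * f z \<noteq> 0"
    by auto
  ultimately show ?thesis
    by (simp add: g_def Moebius_function_simple norm_divide divide_le_eq)
qed

text \<open>Squaring Schwarz-Pick and using |1 - conj(a) b|^2 - |b - a|^2 = (1 - |a|^2) (1 - |b|^2)
  with a = f 0, b = f z. The 4 bounds (1 + |a|) (1 + |b|). The constant depends on \<open>f\<close>
  only through |f 0|, hence is uniform over a family of slices once |f 0| is controlled.\<close>

lemma one_minus_norm_holomorphic_lower:
  assumes holf: "f holomorphic_on ball 0 1" and fim: "f ` ball 0 1 \<subseteq> ball 0 1"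
    and z: "z \<in> ball (0::complex) 1"
  shows "(1 - cmod (f 0)) / 4 * (1 - cmod z) \<le> 1 - cmod (f z)"
proof -
  have lt1: "cmod (f w) < 1" if "cmod w < 1" for w
    using fim that by (auto simp: image_subset_iff)
  define a b r where "a = cmod (f 0)" and "b = cmod (f z)" and "r = cmod z"
  have bounds: "0 \<le> a" "a < 1" "0 \<le> b" "b < 1" "0 \<le> r" "r < 1"
    using lt1[of 0] lt1[of z] z by (auto simp: a_def b_def r_def)
  define D where "D = cmod (1 - cnj (f 0) * f z)"
  have "D\<^sup>2 - (cmod (f z - f 0))\<^sup>2 = (1 - a\<^sup>2) * (1 - b\<^sup>2)"
    unfolding D_def a_def b_def cmod_power2 by (simp add: algebra_simps power2_eq_square)
  moreover have "(cmod (f z - f 0))\<^sup>2 \<le> (r * D)\<^sup>2"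
    using Schwarz_Pick_at_0[OF assms] unfolding r_def D_def by (intro power_mono) auto
  ultimately have 1: "(1 - r\<^sup>2) * D\<^sup>2 \<le> (1 - a\<^sup>2) * (1 - b\<^sup>2)"
    by (simp add: power_mult_distrib algebra_simps)
  have "1 - a * b \<le> D"
    unfolding D_def a_def b_def using norm_triangle_ineq2[of 1 "cnj (f 0) * f z"]
    by (simp add: norm_mult)
  moreover have "1 - a \<le> 1 - a * b"
    using bounds by (simp add: mult_left_le)
  ultimately have "(1 - a)\<^sup>2 \<le> D\<^sup>2"
    using bounds by (intro power_mono) auto
  moreover have "0 \<le> 1 - r\<^sup>2"
    using bounds by (simp add: power_le_one)
  ultimately have "(1 - r\<^sup>2) * (1 - a)\<^sup>2 \<le> (1 - a\<^sup>2) * (1 - b\<^sup>2)"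
    using 1 by (meson mult_left_mono order_trans)
  then have "(1 - a) * ((1 - r\<^sup>2) * (1 - a)) \<le> (1 - a) * ((1 + a) * (1 - b\<^sup>2))"
    by (simp add: power2_eq_square algebra_simps)
  then have "(1 - r\<^sup>2) * (1 - a) \<le> (1 + a) * (1 - b\<^sup>2)"
    using bounds by (simp add: mult_le_cancel_left)
  also have "\<dots> = ((1 + a) * (1 + b)) * (1 - b)"
    by (simp add: algebra_simps power2_eq_square)
  also have "\<dots> \<le> (2 * 2) * (1 - b)"
    using bounds by (intro mult_right_mono mult_mono) auto
  finally have "(1 - r\<^sup>2) * (1 - a) \<le> 4 * (1 - b)"
    by simp
  moreover have "(1 - r) * (1 - a) \<le> (1 - r\<^sup>2) * (1 - a)"
    using bounds by (intro mult_right_mono) (auto simp: power2_eq_square mult_left_le)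
  ultimately show ?thesis
    unfolding a_def b_def r_def by (simp add: field_simps)
qed

text \<open>Abstract in \<open>g\<close> so that either coordinate can play the role of
  \<open>z\<close>. Slices over the open disc are holomorphic self-maps; boundary values of
  \<open>w\<close> are reached by radial limits. They are included because the normal derivative at
  a torus point is computed along a radius in \<open>z\<close> with \<open>w\<close> on the
  circle.\<close>

lemma hopf_bound:
  fixes g :: "complex \<Rightarrow> complex \<Rightarrow> complex"
  assumes hol: "\<And>w. w \<in> ball 0 1 \<Longrightarrow> (\<lambda>z. g z w) holomorphic_on ball 0 1"
    and im: "\<And>z w. z \<in> ball 0 1 \<Longrightarrow> w \<in> ball 0 1 \<Longrightarrow> g z w \<in> ball 0 1"
    and cont: "continuous_on (cball 0 1 \<times> cball 0 1) (\<lambda>(z, w). g z w)"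
    and \<zeta>: "\<zeta> \<in> sphere 0 1"
    and nonconst: "a \<in> cball 0 1" "g a \<zeta> \<noteq> g 0 \<zeta>"
  obtains c \<rho> where "c > 0" "\<rho> > 0"
    "\<And>z w. z \<in> ball 0 1 \<Longrightarrow> w \<in> cball 0 1 \<Longrightarrow> dist w \<zeta> < \<rho> \<Longrightarrow>
       c * (1 - cmod z) \<le> 1 - cmod (g z w)"
proof -
  have contz: "continuous_on (cball 0 1) (\<lambda>z. g z w)" if "w \<in> cball 0 1" for w
  proof -
    have "continuous_on (cball 0 1) (\<lambda>z. case (z, w) of (z, w) \<Rightarrow> g z w)"
      by (rule continuous_on_compose2[OF cont]) (use that in \<open>auto intro!: continuous_intros\<close>)
    then show ?thesis
      by simp
  qed
  have contw: "continuous_on (cball 0 1) (\<lambda>w. g z w)" if "z \<in> cball 0 1" for z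
  proof -
    have "continuous_on (cball 0 1) (\<lambda>w. case (z, w) of (z, w) \<Rightarrow> g z w)"
      by (rule continuous_on_compose2[OF cont]) (use that in \<open>auto intro!: continuous_intros\<close>)
    then show ?thesis
      by simp
  qed
  have radial: "((\<lambda>r. g z (of_real r * w)) \<longlongrightarrow> g z w) (at_left 1)"
    if "z \<in> cball 0 1" "w \<in> cball 0 1" for z w
  proof -
    have "continuous_on {0..1} (\<lambda>r. g z (of_real r * w))"
      by (rule continuous_on_compose2[OF contw[OF that(1)]])
        (use that in \<open>auto intro!: continuous_intros mult_le_one simp: norm_mult\<close>)
    then have "((\<lambda>r. g z (of_real r * w)) \<longlongrightarrow> g z (of_real 1 * w)) (at 1 within {0..1})"
      unfolding continuous_on by (metis atLeastAtMost_iff order_refl zero_le_one)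
    then show ?thesis
      by (simp add: at_within_Icc_at_left)
  qed
  have ev: "eventually (\<lambda>r::real. 0 < r \<and> r < 1) (at_left 1)"
    using eventually_at_left_real[of 0 1] by (rule eventually_mono) auto
  have scaled: "of_real r * w \<in> ball 0 1" if "0 < r" "r < 1" "w \<in> cball 0 1" for r :: real and w :: complex
  proof -
    have "r * cmod w \<le> r * 1"
      using that by (intro mult_left_mono) auto
    then have "r * cmod w < 1"
      using that by linarith
    then show ?thesis
      using that by (simp add: norm_mult)
  qed
  have le1: "cmod (g z w) \<le> 1" if "z \<in> ball 0 1" "w \<in> cball 0 1" for z w
  proof (rule tendsto_upperbound[OF tendsto_norm[OF radial]])
    show "\<forall>\<^sub>F r in at_left 1. cmod (g z (of_real r * w)) \<le> 1"
      using ev by (rule eventually_mono) (use im[OF that(1) scaled[OF _ _ that(2)]] in fastforce)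
  qed (use that in auto)
  have \<zeta>': "\<zeta> \<in> cball 0 1" "0 \<in> ball (0::complex) 1"
    using \<zeta> by auto
  \<comment> \<open>Holomorphy is assumed only for |w| < 1, so instead of the maximum principle the
    Schwarz-Pick inequality is passed to the limit w -> \<zeta>. If |g 0 \<zeta>| = 1, its
    right-hand side becomes |z| |g z \<zeta> - g 0 \<zeta>|, which forces the slice to be constant,
    against \<open>nonconst\<close>.\<close>
  have lt1: "cmod (g 0 \<zeta>) < 1"
  proof (rule ccontr)
    assume "\<not> ?thesis"
    with le1[OF \<zeta>'(2,1)] have eq1: "cmod (g 0 \<zeta>) = 1"
      by simp
    have eq: "g z \<zeta> = g 0 \<zeta>" if z: "z \<in> ball 0 1" for z
    proof -
      have z': "z \<in> cball 0 1"
        using z by auto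
      have "cmod (g z \<zeta> - g 0 \<zeta>) \<le> cmod z * cmod (1 - cnj (g 0 \<zeta>) * g z \<zeta>)"
      proof (rule tendsto_le)
        show "((\<lambda>r. cmod z * cmod (1 - cnj (g 0 (of_real r * \<zeta>)) * g z (of_real r * \<zeta>)))
           \<longlongrightarrow> cmod z * cmod (1 - cnj (g 0 \<zeta>) * g z \<zeta>)) (at_left 1)"
          by (intro tendsto_intros radial \<zeta>' z') auto
        show "((\<lambda>r. cmod (g z (of_real r * \<zeta>) - g 0 (of_real r * \<zeta>)))
           \<longlongrightarrow> cmod (g z \<zeta> - g 0 \<zeta>)) (at_left 1)"
          by (intro tendsto_intros radial \<zeta>' z') auto
        show "\<forall>\<^sub>F r in at_left 1. cmod (g z (of_real r * \<zeta>) - g 0 (of_real r * \<zeta>))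
            \<le> cmod z * cmod (1 - cnj (g 0 (of_real r * \<zeta>)) * g z (of_real r * \<zeta>))"
          using ev
        proof (rule eventually_mono)
          fix r :: real
          assume "0 < r \<and> r < 1"
          then have r: "of_real r * \<zeta> \<in> ball 0 1"
            using scaled \<zeta>' by blast
          show "cmod (g z (of_real r * \<zeta>) - g 0 (of_real r * \<zeta>))
            \<le> cmod z * cmod (1 - cnj (g 0 (of_real r * \<zeta>)) * g z (of_real r * \<zeta>))"
            by (rule Schwarz_Pick_at_0[OF hol[OF r]]) (use im[OF _ r] z in auto)
        qed
      qed simp
      also have "cmod (1 - cnj (g 0 \<zeta>) * g z \<zeta>) = cmod (g z \<zeta> - g 0 \<zeta>)"
      proof -
        have "cnj (g 0 \<zeta>) * g 0 \<zeta> = 1"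
          by (metis complex_norm_square eq1 mult.commute of_real_1 one_power2)
        then have "1 - cnj (g 0 \<zeta>) * g z \<zeta> = cnj (g 0 \<zeta>) * (g 0 \<zeta> - g z \<zeta>)"
          by (simp add: algebra_simps)
        then show ?thesis
          by (simp add: norm_mult eq1 norm_minus_commute)
      qed
      finally have "(1 - cmod z) * cmod (g z \<zeta> - g 0 \<zeta>) \<le> 0"
        by (simp add: algebra_simps)
      moreover have "1 - cmod z > 0"
        using z by simp
      ultimately have "cmod (g z \<zeta> - g 0 \<zeta>) \<le> 0"
        by (simp add: mult_le_0_iff)
      then show ?thesis
        by simp
    qed
    have "g a \<zeta> = g 0 \<zeta>"
    proof (rule continuous_constant_on_closure[of "ball 0 1" "\<lambda>z. g z \<zeta>"])
      show "continuous_on (closure (ball 0 1)) (\<lambda>z. g z \<zeta>)"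
        using contz[OF \<zeta>'(1)] by simp
      show "a \<in> closure (ball 0 1)"
        using nonconst by simp
    qed (rule eq)
    with nonconst show False
      by simp
  qed
  \<comment> \<open>Half of the gap at \<zeta>: continuity in \<open>w\<close> keeps 1 - |g 0 w|
    above \<open>m\<close> near \<zeta>, giving one constant for all these slices.\<close>
  define m where "m = (1 - cmod (g 0 \<zeta>)) / 2"
  have m: "m > 0"
    using lt1 by (simp add: m_def)
  obtain \<rho> where \<rho>: "\<rho> > 0"
    "\<And>w. w \<in> cball 0 1 \<Longrightarrow> dist w \<zeta> < \<rho> \<Longrightarrow> dist (g 0 w) (g 0 \<zeta>) < m"
    using contw[of 0] m \<zeta>' unfolding continuous_on_iff by fastforce
  have near: "m \<le> 1 - cmod (g 0 w)" if "w \<in> cball 0 1" "dist w \<zeta> < \<rho>" for w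
    using \<rho>(2)[OF that] norm_triangle_ineq2[of "g 0 w" "g 0 \<zeta>"] by (simp add: m_def dist_norm field_simps)
  have open_bound: "m / 4 * (1 - cmod z) \<le> 1 - cmod (g z w)"
    if z: "z \<in> ball 0 1" and w: "w \<in> ball 0 1" "dist w \<zeta> < \<rho>" for z w
  proof -
    have "m / 4 * (1 - cmod z) \<le> (1 - cmod (g 0 w)) / 4 * (1 - cmod z)"
      using near[of w] z w by (intro mult_right_mono divide_right_mono) auto
    also have "\<dots> \<le> 1 - cmod (g z w)"
      by (rule one_minus_norm_holomorphic_lower[OF hol[OF w(1)] _ z]) (use im w in auto)
    finally show ?thesis .
  qed
  show thesis
  proof
    show "m / 4 > 0" "\<rho> > 0"
      using m \<rho> by auto
    show "m / 4 * (1 - cmod z) \<le> 1 - cmod (g z w)"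
      if z: "z \<in> ball 0 1" and w: "w \<in> cball 0 1" "dist w \<zeta> < \<rho>" for z w
    proof (rule tendsto_lowerbound)
      show "((\<lambda>r. 1 - cmod (g z (of_real r * w))) \<longlongrightarrow> 1 - cmod (g z w)) (at_left 1)"
        using z w by (intro tendsto_intros radial) auto
      have "((\<lambda>r. dist (of_real r * w) \<zeta>) \<longlongrightarrow> dist (of_real 1 * w) \<zeta>) (at_left 1)"
        by (intro tendsto_intros)
      then have "\<forall>\<^sub>F r in at_left 1. dist (of_real r * w) \<zeta> < \<rho>"
        using w(2) order_tendstoD(2) by fastforce
      with ev show "\<forall>\<^sub>F r in at_left 1. m / 4 * (1 - cmod z) \<le> 1 - cmod (g z (of_real r * w))"
        by eventually_elim (use open_bound[OF z] scaled[OF _ _ w(1)] in blast)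
    qed simp
  qed
qed

subsection \<open>Sublevel sets of planar maps\<close>

text \<open>The total derivative at every point, given through named partials, so that applying the
  predicate again to \<open>F1\<close> and \<open>F2\<close> expresses second-order
  differentiability in a form that the chain rule along lines can use.\<close>

definition has_partials :: "(real \<times> real \<Rightarrow> complex) \<Rightarrow> (real \<times> real \<Rightarrow> complex) \<Rightarrow> (real \<times> real \<Rightarrow> complex) \<Rightarrow> bool" where
  "has_partials F F1 F2 \<longleftrightarrow>
     (\<forall>p. (F has_derivative (\<lambda>h. fst h *\<^sub>R F1 p + snd h *\<^sub>R F2 p)) (at p))"

lemma has_partials_line:
  assumes "has_partials F F1 F2"
  shows "((\<lambda>t. F (p + t *\<^sub>R h)) has_vector_derivative
     (fst h *\<^sub>R F1 (p + t *\<^sub>R h) + snd h *\<^sub>R F2 (p + t *\<^sub>R h))) (at t)"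
proof -
  have "((\<lambda>t. p + t *\<^sub>R h) has_derivative (\<lambda>s. s *\<^sub>R h)) (at t)"
    by (auto intro!: derivative_eq_intros)
  moreover have "(F has_derivative (\<lambda>k. fst k *\<^sub>R F1 (p + t *\<^sub>R h) + snd k *\<^sub>R F2 (p + t *\<^sub>R h)))
    (at (p + t *\<^sub>R h))"
    using assms unfolding has_partials_def by blast
  ultimately have "((\<lambda>t. F (p + t *\<^sub>R h)) has_derivative
     (\<lambda>s. fst (s *\<^sub>R h) *\<^sub>R F1 (p + t *\<^sub>R h) + snd (s *\<^sub>R h) *\<^sub>R F2 (p + t *\<^sub>R h))) (at t)"
    by (rule has_derivative_compose)
  then show ?thesis
    by (simp add: has_vector_derivative_def scaleR_add_right)
qed

text \<open>Monotonicity twice: f'(t) + k t is nonincreasing on [0, T], hence so is f(t) - f'(0) t +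
  k t^2 / 2.\<close>

lemma taylor2_upper:
  fixes f f' f'' :: "real \<Rightarrow> real"
  assumes "\<And>t. 0 \<le> t \<Longrightarrow> t \<le> T \<Longrightarrow> (f has_real_derivative f' t) (at t)"
    and "\<And>t. 0 \<le> t \<Longrightarrow> t \<le> T \<Longrightarrow> (f' has_real_derivative f'' t) (at t)"
    and "\<And>t. 0 \<le> t \<Longrightarrow> t \<le> T \<Longrightarrow> f'' t \<le> - k" and "0 \<le> T"
  shows "f T - f 0 \<le> f' 0 * T - k / 2 * T\<^sup>2"
proof -
  have f': "f' t \<le> f' 0 - k * t" if "0 \<le> t" "t \<le> T" for t
  proof -
    have "f' t + k * t \<le> f' 0 + k * 0"
      by (rule DERIV_nonpos_imp_nonincreasing[of 0 t])
        (use that assms in \<open>force intro!: exI derivative_eq_intros\<close>)+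
    then show ?thesis
      by simp
  qed
  have "f T - f' 0 * T + k / 2 * T\<^sup>2 \<le> f 0 - f' 0 * 0 + k / 2 * 0\<^sup>2"
  proof (rule DERIV_nonpos_imp_nonincreasing[OF \<open>0 \<le> T\<close>])
    fix t assume t: "0 \<le> t" "t \<le> T"
    have "((\<lambda>t. f t - f' 0 * t + k / 2 * t\<^sup>2) has_real_derivative f' t - f' 0 + k * t) (at t)"
      using assms(1)[OF t] by (auto intro!: derivative_eq_intros)
    moreover have "f' t - f' 0 + k * t \<le> 0"
      using f'[OF t] by simp
    ultimately show "\<exists>y. ((\<lambda>t. f t - f' 0 * t + k / 2 * t\<^sup>2) has_real_derivative y) (at t) \<and> y \<le> 0"
      by blast
  qed
  then show ?thesis
    by simp
qed

section \<open>Counting the grid cells met by a subset of the line\<close>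

lemma floor_image_card:
  assumes "\<delta> > 0" "d \<ge> 0"
  shows "finite ((\<lambda>s. \<lfloor>s / \<delta>\<rfloor>) ` {m..m + d})"
    and "real (card ((\<lambda>s. \<lfloor>s / \<delta>\<rfloor>) ` {m..m + d})) \<le> d / \<delta> + 2"
proof -
  have sub: "(\<lambda>s. \<lfloor>s / \<delta>\<rfloor>) ` {m..m + d} \<subseteq> {\<lfloor>m / \<delta>\<rfloor>..\<lfloor>(m + d) / \<delta>\<rfloor>}"
    using assms by (auto intro!: floor_mono divide_right_mono)
  then show "finite ((\<lambda>s. \<lfloor>s / \<delta>\<rfloor>) ` {m..m + d})"
    by (rule finite_subset) simp
  have "card ((\<lambda>s. \<lfloor>s / \<delta>\<rfloor>) ` {m..m + d}) \<le> card {\<lfloor>m / \<delta>\<rfloor>..\<lfloor>(m + d) / \<delta>\<rfloor>}"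
    by (rule card_mono[OF _ sub]) simp
  also have "real \<dots> = of_int (\<lfloor>(m + d) / \<delta>\<rfloor> - \<lfloor>m / \<delta>\<rfloor> + 1)"
    using floor_mono[of "m / \<delta>" "(m + d) / \<delta>"] assms by (simp add: divide_right_mono)
  \<comment> \<open>One unit comes from counting both end cells, the other from rounding down at the
    left end; hence the summand 2.\<close>
  also have "\<dots> \<le> (m + d) / \<delta> - (m / \<delta> - 1) + 1"
    by linarith
  also have "\<dots> = d / \<delta> + 2"
    by (simp add: add_divide_distrib)
  finally show "real (card ((\<lambda>s. \<lfloor>s / \<delta>\<rfloor>) ` {m..m + d})) \<le> d / \<delta> + 2"
    by simp
qed

text \<open>A point more than \<open>d\<close> away from both \<open>Inf P\<close> and
  \<open>Sup P\<close> would be the middle of a triple with both gaps larger than \<open>d\<close>.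
  The outer members are points of \<open>P\<close> close to the extremes, since the extremes need
  not be attained.\<close>

lemma three_point_cover:
  fixes P :: "real set"
  assumes "bounded P" and "d \<ge> 0"
    and "\<And>s1 s2 s3. s1 \<in> P \<Longrightarrow> s2 \<in> P \<Longrightarrow> s3 \<in> P \<Longrightarrow> s1 < s2 \<Longrightarrow> s2 < s3 \<Longrightarrow> s2 - s1 \<le> d \<or> s3 - s2 \<le> d"
  shows "P \<subseteq> {Inf P..Inf P + d} \<union> {Sup P - d..Sup P}"
proof
  fix s assume s: "s \<in> P"
  have bdd: "bdd_below P" "bdd_above P"
    using assms(1) by (auto intro: bounded_imp_bdd_below bounded_imp_bdd_above)
  have le: "Inf P \<le> s" "s \<le> Sup P"
    using s bdd by (auto intro: cInf_lower cSup_upper)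
  show "s \<in> {Inf P..Inf P + d} \<union> {Sup P - d..Sup P}"
  proof (rule ccontr)
    assume "\<not> ?thesis"
    with le have far: "Inf P < s - d" "s + d < Sup P"
      by auto
    obtain s1 where "s1 \<in> P" "s1 < s - d"
      using far(1) s by (metis cInf_lessD empty_iff)
    moreover obtain s3 where "s3 \<in> P" "s + d < s3"
      using far(2) s by (metis less_cSupD empty_iff)
    ultimately show False
      using assms(3)[of s1 s s3] s assms(2) by auto
  qed
qed

lemma three_point_floor_card:
  fixes P :: "real set"
  assumes "bounded P" and "d \<ge> 0" and "\<delta> > 0"
    and "\<And>s1 s2 s3. s1 \<in> P \<Longrightarrow> s2 \<in> P \<Longrightarrow> s3 \<in> P \<Longrightarrow> s1 < s2 \<Longrightarrow> s2 < s3 \<Longrightarrow> s2 - s1 \<le> d \<or> s3 - s2 \<le> d"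
  shows "finite ((\<lambda>s. \<lfloor>s / \<delta>\<rfloor>) ` P)" and "real (card ((\<lambda>s. \<lfloor>s / \<delta>\<rfloor>) ` P)) \<le> 2 * (d / \<delta> + 2)"
proof -
  let ?f = "\<lambda>s. \<lfloor>s / \<delta>\<rfloor>"
  have sub: "?f ` P \<subseteq> ?f ` {Inf P..Inf P + d} \<union> ?f ` {Sup P - d..Sup P - d + d}"
    using three_point_cover[OF assms(1,2,4)] by (simp flip: image_Un add: image_mono)
  note fin = floor_image_card(1)[OF assms(3,2)]
  show "finite (?f ` P)"
    by (rule finite_subset[OF sub]) (intro finite_UnI fin)
  have "card (?f ` P) \<le> card (?f ` {Inf P..Inf P + d} \<union> ?f ` {Sup P - d..Sup P - d + d})"
    by (rule card_mono[OF _ sub]) (intro finite_UnI fin)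
  also have "\<dots> \<le> card (?f ` {Inf P..Inf P + d}) + card (?f ` {Sup P - d..Sup P - d + d})"
    by (rule card_Un_le)
  finally have "real (card (?f ` P))
      \<le> real (card (?f ` {Inf P..Inf P + d})) + real (card (?f ` {Sup P - d..Sup P - d + d}))"
    by (metis of_nat_add of_nat_mono)
  also have "\<dots> \<le> (d / \<delta> + 2) + (d / \<delta> + 2)"
    by (intro add_mono floor_image_card(2) assms)
  finally show "real (card (?f ` P)) \<le> 2 * (d / \<delta> + 2)"
    by simp
qed

section \<open>Covering a planar sublevel set by few squares of side O(\<delta>)\<close>

lemma has_partials_continuous:
  assumes "has_partials F F1 F2"
  shows "continuous_on S F"
  using assms unfolding has_partials_def
  by (meson continuous_at_imp_continuous_on has_derivative_continuous)

text \<open>Compactness of the unit sphere gives a negative maximum at parameter 0, and uniform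
  continuity on ball times sphere keeps half of it for nearby parameters. In use the parameter is a
  pair of points of the plane.\<close>

lemma uniform_negative_on_sphere:
  fixes f :: "'a::euclidean_space \<Rightarrow> 'b::euclidean_space \<Rightarrow> real"
  assumes cont: "continuous_on UNIV (\<lambda>(x, h). f x h)"
    and neg: "\<And>h. norm h = 1 \<Longrightarrow> f 0 h < 0"
  obtains \<kappa> \<epsilon> where "\<kappa> > 0" "\<epsilon> > 0" "\<And>x h. norm x < \<epsilon> \<Longrightarrow> norm h = 1 \<Longrightarrow> f x h \<le> - \<kappa>"
proof -
  have "continuous_on (sphere 0 1) (f 0)"
    using continuous_on_compose2[OF cont continuous_on_Pair[OF continuous_on_const continuous_on_id]]
    by (auto simp: case_prod_unfold)
  moreover have "sphere (0::'b) 1 \<noteq> {}"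
    by simp
  ultimately obtain h0 where h0: "h0 \<in> sphere 0 1" "\<And>h. h \<in> sphere 0 1 \<Longrightarrow> f 0 h \<le> f 0 h0"
    using continuous_attains_sup[OF compact_sphere] by metis
  define \<kappa> where "\<kappa> = - f 0 h0 / 2"
  have \<kappa>: "\<kappa> > 0"
    using neg[of h0] h0 by (simp add: \<kappa>_def)
  have "uniformly_continuous_on (cball 0 1 \<times> sphere 0 1) (\<lambda>(x, h). f x h)"
    by (intro compact_uniformly_continuous continuous_on_subset[OF cont] compact_Times) auto
  then obtain d where d: "d > 0" "\<And>y y'. y \<in> cball 0 1 \<times> sphere 0 1 \<Longrightarrow> y' \<in> cball 0 1 \<times> sphere 0 1 \<Longrightarrow>
      dist y' y < d \<Longrightarrow> dist ((\<lambda>(x, h). f x h) y') ((\<lambda>(x, h). f x h) y) < \<kappa>"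
    using \<kappa> unfolding uniformly_continuous_on_def by metis
  show thesis
  proof
    show "\<kappa> > 0" "min d 1 > 0"
      using \<kappa> d by auto
    fix x :: 'a and h :: 'b
    assume x: "norm x < min d 1" and h: "norm h = 1"
    have "dist (f x h) (f 0 h) < \<kappa>"
      using d(2)[of "(0, h)" "(x, h)"] x h by (auto simp: dist_Pair_Pair)
    moreover have "f 0 h \<le> - 2 * \<kappa>"
      using h0(2)[of h] h by (simp add: \<kappa>_def)
    ultimately show "f x h \<le> - \<kappa>"
      by (simp add: dist_real_def abs_if split: if_splits)
  qed
qed

text \<open>\<open>neg\<close> says that the real component of \<open>F\<close> which is stationary
  in the first variable at 0 is strictly concave there. \<eta> enters the estimates only through
  differences \<open>F p - F q\<close> of size below 2 \<delta>, so \<open>\<epsilon>\<close> and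
  \<open>K\<close> do not depend on it.\<close>

lemma planar_sublevel_cover:
  fixes F :: "real \<times> real \<Rightarrow> complex"
  assumes hp: "has_partials F F1 F2" "has_partials F1 F11 F12" "has_partials F2 F21 F22"
    and cont: "continuous_on UNIV F11" "continuous_on UNIV F12" "continuous_on UNIV F21" "continuous_on UNIV F22"
    and F1_0: "F1 0 \<noteq> 0"
    and neg: "\<And>h. norm h = 1 \<Longrightarrow> Re (\<i> * cnj (F1 0) *
      (fst h *\<^sub>R (fst h *\<^sub>R F11 0 + snd h *\<^sub>R F12 0) + snd h *\<^sub>R (fst h *\<^sub>R F21 0 + snd h *\<^sub>R F22 0))) < 0"
  obtains \<epsilon> K where "\<epsilon> > 0" "K > 0"
    "\<And>\<eta> \<delta>. 0 < \<delta> \<Longrightarrow> \<delta> \<le> 1 \<Longrightarrow> \<exists>T. finite T \<and> real (card T) \<le> K / sqrt \<delta> \<and>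
       (\<forall>p. norm p < \<epsilon> \<longrightarrow> cmod (F p - \<eta>) < \<delta> \<longrightarrow>
         (\<exists>t\<in>T. \<bar>fst p - fst t\<bar> \<le> K * \<delta> \<and> \<bar>snd p - snd t\<bar> \<le> K * \<delta>))"
proof -
  define H where "H p h = fst h *\<^sub>R (fst h *\<^sub>R F11 p + snd h *\<^sub>R F12 p)
      + snd h *\<^sub>R (fst h *\<^sub>R F21 p + snd h *\<^sub>R F22 p)" for p h :: "real \<times> real"
  \<comment> \<open>\<open>fst x\<close> selects the functional and \<open>snd x\<close> the point
    where the Hessian is evaluated: in a Taylor expansion from \<open>p\<close> the functional stays
    that of \<open>p\<close>, while the Hessian is needed along the whole segment.\<close>
  define W where "W x h = Re (\<i> * cnj (F1 (fst x)) * H (snd x) h)" for x :: "(real \<times> real) \<times> real \<times> real" and h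
  note contF = has_partials_continuous[OF hp(1)] has_partials_continuous[OF hp(2)] has_partials_continuous[OF hp(3)]
  have cont2: "continuous_on UNIV (\<lambda>x. f (g x))" if "continuous_on UNIV f" "continuous_on UNIV g"
    for f :: "real \<times> real \<Rightarrow> complex" and g :: "((real \<times> real) \<times> real \<times> real) \<times> real \<times> real \<Rightarrow> real \<times> real"
    using continuous_on_compose2[OF that] by simp
  have contW: "continuous_on UNIV (\<lambda>(x, h). W x h)"
    unfolding W_def H_def case_prod_unfold
    by (intro continuous_intros cont2[OF contF(2)] cont[THEN cont2])
  have negW: "W 0 h < 0" if "norm h = 1" for h
    using neg[OF that] by (simp add: W_def H_def)
  obtain \<kappa> \<epsilon>1 where \<kappa>: "\<kappa> > 0" "\<epsilon>1 > 0" "\<And>x h. norm x < \<epsilon>1 \<Longrightarrow> norm h = 1 \<Longrightarrow> W x h \<le> - \<kappa>"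
    by (rule uniform_negative_on_sphere[OF contW negW]) (assumption, rule that)
  \<comment> \<open>Half of |F1 0|^2, so that Re(conj(F1 0) F1 p) > c persists near 0: this
    component of \<open>F\<close> increases in the first variable at rate at least
    \<open>c\<close>.\<close>
  define c where "c = (cmod (F1 0))\<^sup>2 / 2"
  have c: "c > 0"
    using F1_0 by (simp add: c_def)
  have "continuous_on UNIV (\<lambda>p. Re (cnj (F1 0) * F1 p))"
    by (intro continuous_intros contF)
  moreover have "Re (cnj (F1 0) * F1 0) = 2 * c"
    by (simp add: c_def cmod_power2) (simp add: power2_eq_square)
  ultimately obtain \<epsilon>2 where \<epsilon>2: "\<epsilon>2 > 0" "\<And>p. norm p < \<epsilon>2 \<Longrightarrow> dist (Re (cnj (F1 0) * F1 p)) (2 * c) < c"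
    using c unfolding continuous_on_iff by (metis UNIV_I dist_0_norm dist_commute)
  obtain M1 where M1: "M1 > 0" "\<And>p. norm p \<le> 1 \<Longrightarrow> cmod (F1 p) \<le> M1"
  proof -
    have "bounded (F1 ` cball 0 1)"
      by (intro compact_imp_bounded compact_continuous_image contF compact_cball)
    then show ?thesis
      using that by (auto simp: bounded_pos)
  qed
  obtain M2 where M2: "M2 > 0" "\<And>p. norm p \<le> 1 \<Longrightarrow> cmod (F2 p) \<le> M2"
  proof -
    have "bounded (F2 ` cball 0 1)"
      by (intro compact_imp_bounded compact_continuous_image contF compact_cball)
    then show ?thesis
      using that by (auto simp: bounded_pos)
  qed
  \<comment> \<open>Halving \<open>\<epsilon>1\<close> leaves room for the norm of a pair of points;
    the bound 1 keeps both points where \<open>M1\<close> and \<open>M2\<close> apply.\<close>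
  define \<epsilon> where "\<epsilon> = min (min (\<epsilon>1 / 2) \<epsilon>2) 1"
  have \<epsilon>: "\<epsilon> > 0" "\<epsilon> \<le> \<epsilon>1 / 2" "\<epsilon> \<le> \<epsilon>2" "\<epsilon> \<le> 1"
    using \<kappa> \<epsilon>2 by (auto simp: \<epsilon>_def)
  have curv: "W (p, q) h \<le> - \<kappa>" if "norm p < \<epsilon>" "norm q < \<epsilon>" "norm h = 1" for p q h
    using that \<epsilon> norm_Pair_le[of p q] by (intro \<kappa>) auto
  have segment: "norm (p + t *\<^sub>R (q - p)) < \<epsilon>" if "norm p < \<epsilon>" "norm q < \<epsilon>" "0 \<le> t" "t \<le> 1"
    for p q :: "real \<times> real" and t
    using convexD_alt[OF convex_ball, of p 0 \<epsilon> q t] that by (simp add: algebra_simps)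

  text \<open>The functional \<open>w \<mapsto> Re (\<i> * cnj (F1 p) * w)\<close> annihilates \<open>F1 p\<close>, so that the first order term
    of its Taylor expansion at \<open>p\<close> depends on the second coordinate only, and the second
    order term is negative.\<close>
  have one_sided: "snd q - snd p \<le> sqrt (4 * M1 / \<kappa> * \<delta>) \<and> snd p - snd q \<le> sqrt (4 * M1 / \<kappa> * \<delta>)"
    if p: "norm p < \<epsilon>" "cmod (F p - \<eta>) < \<delta>" and q: "norm q < \<epsilon>" "cmod (F q - \<eta>) < \<delta>"
      and sgn: "Re (\<i> * cnj (F1 p) * F2 p) * (snd q - snd p) \<le> 0" for p q \<eta> \<delta>
  proof (cases "p = q")
    case True
    have "\<delta> > 0"
      using p(2) norm_ge_zero order.strict_trans1 by blast
    then show ?thesis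
      using True M1 \<kappa> by simp
  next
    case False
    define T where "T = norm (q - p)"
    define e where "e = (1 / T) *\<^sub>R (q - p)"
    define l where "l w = Re (\<i> * cnj (F1 p) * w)" for w
    have T: "T > 0"
      using False by (simp add: T_def)
    have e: "norm e = 1" "T *\<^sub>R e = q - p"
      using T by (auto simp: e_def T_def)
    have l: "bounded_linear l"
      unfolding l_def by (rule bounded_linear_compose[OF bounded_linear_Re bounded_linear_mult_right])
    have "l (F (p + T *\<^sub>R e)) - l (F (p + 0 *\<^sub>R e))
      \<le> l (fst e *\<^sub>R F1 (p + 0 *\<^sub>R e) + snd e *\<^sub>R F2 (p + 0 *\<^sub>R e)) * T - \<kappa> / 2 * T\<^sup>2"
    proof (rule taylor2_upper[where f = "\<lambda>t. l (F (p + t *\<^sub>R e))"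
            and f' = "\<lambda>t. l (fst e *\<^sub>R F1 (p + t *\<^sub>R e) + snd e *\<^sub>R F2 (p + t *\<^sub>R e))"
            and f'' = "\<lambda>t. l (H (p + t *\<^sub>R e) e)"])
      fix t :: real
      assume t: "0 \<le> t" "t \<le> T"
      show "((\<lambda>t. l (F (p + t *\<^sub>R e))) has_real_derivative
          l (fst e *\<^sub>R F1 (p + t *\<^sub>R e) + snd e *\<^sub>R F2 (p + t *\<^sub>R e))) (at t)"
        unfolding has_real_derivative_iff_has_vector_derivative
        by (rule bounded_linear.has_vector_derivative[OF l has_partials_line[OF hp(1)]])
      show "((\<lambda>t. l (fst e *\<^sub>R F1 (p + t *\<^sub>R e) + snd e *\<^sub>R F2 (p + t *\<^sub>R e))) has_real_derivative
          l (H (p + t *\<^sub>R e) e)) (at t)"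
        unfolding has_real_derivative_iff_has_vector_derivative H_def
        by (intro bounded_linear.has_vector_derivative[OF l] has_vector_derivative_add
            bounded_linear.has_vector_derivative[OF bounded_linear_scaleR_right]
            has_partials_line hp)
      have "p + t *\<^sub>R e = p + (t / T) *\<^sub>R (q - p)"
        using T by (simp add: e_def)
      moreover have "norm (p + (t / T) *\<^sub>R (q - p)) < \<epsilon>"
        using segment[OF p(1) q(1), of "t / T"] t T by simp
      ultimately show "l (H (p + t *\<^sub>R e) e) \<le> - \<kappa>"
        using curv[OF p(1) _ e(1), of "p + t *\<^sub>R e"] by (simp add: W_def l_def)
    qed (use T in simp)
    moreover have "l (fst e *\<^sub>R F1 p + snd e *\<^sub>R F2 p) * T \<le> 0"
    proof -
      have "l (F1 p) = 0"
        by (simp add: l_def)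
      then have "l (fst e *\<^sub>R F1 p + snd e *\<^sub>R F2 p) * T = l (F2 p) * snd (T *\<^sub>R e)"
        using l by (simp add: linear_simps algebra_simps)
      then show ?thesis
        using sgn by (simp add: e(2) l_def)
    qed
    \<comment> \<open>The sign hypothesis disposes of the first-order term, so the functional drops
      by at least \<kappa> T^2 / 2 from \<open>p\<close> to \<open>q\<close>. Both values of
      \<open>F\<close> lie within \<delta> of \<eta>, so the drop is at most 2 M1 \<delta>, whence T
      = O(sqrt \<delta>).\<close>
    ultimately have "\<kappa> / 2 * T\<^sup>2 \<le> l (F p) - l (F q)"
      using e(2) by simp
    also have "\<dots> = l (F p - F q)"
      using l by (simp add: linear_simps)
    also have "\<dots> \<le> cmod (\<i> * cnj (F1 p) * (F p - F q))"
      unfolding l_def by (rule complex_Re_le_cmod)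
    also have "\<dots> = cmod (F1 p) * cmod (F p - F q)"
      by (simp add: norm_mult)
    also have "\<dots> \<le> M1 * (2 * \<delta>)"
    proof (intro mult_mono)
      show "cmod (F1 p) \<le> M1"
        using p \<epsilon> by (intro M1) simp
      show "cmod (F p - F q) \<le> 2 * \<delta>"
        using norm_triangle_ineq4[of "F p - \<eta>" "F q - \<eta>"] p q by simp
    qed (use M1 in auto)
    finally have "T\<^sup>2 \<le> 4 * M1 / \<kappa> * \<delta>"
      using \<kappa> by (simp add: field_simps)
    then have "T \<le> sqrt (4 * M1 / \<kappa> * \<delta>)"
      by (rule real_le_rsqrt)
    moreover have "\<bar>snd (q - p)\<bar> \<le> T"
      unfolding T_def by (metis norm_snd_le prod.collapse real_norm_def)
    ultimately have "\<bar>snd q - snd p\<bar> \<le> sqrt (4 * M1 / \<kappa> * \<delta>)"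
      unfolding snd_diff by (rule order_trans[rotated])
    then show ?thesis
      by linarith
  qed

  \<comment> \<open>Along the segment from \<open>q\<close> to \<open>p\<close> the component
    Re(conj(F1 0) F) grows at rate at least \<open>c\<close> in the first variable. Its total change
    is O(\<delta>), and the displacement of at most \<delta> in the second variable contributes
    O(\<delta>) as well.\<close>
  have fst_bound: "fst p - fst q \<le> (2 * M1 + M1 * M2) / c * \<delta>"
    if p: "norm p < \<epsilon>" "cmod (F p - \<eta>) < \<delta>" and q: "norm q < \<epsilon>" "cmod (F q - \<eta>) < \<delta>"
      and snd: "\<bar>snd p - snd q\<bar> \<le> \<delta>" for p q \<eta> \<delta>
  proof (cases "fst q \<le> fst p")
    case False
    have "\<delta> > 0"
      using p(2) norm_ge_zero order.strict_trans1 by blast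
    then have "0 \<le> (2 * M1 + M1 * M2) / c * \<delta>"
      using M1 M2 c by simp
    with False show ?thesis
      by simp
  next
    case True
    define h where "h = p - q"
    define l where "l w = Re (cnj (F1 0) * w)" for w
    have l: "bounded_linear l"
      unfolding l_def by (rule bounded_linear_compose[OF bounded_linear_Re bounded_linear_mult_right])
    have l_le: "\<bar>l w\<bar> \<le> M1 * cmod w" for w
    proof -
      have "\<bar>l w\<bar> \<le> cmod (F1 0) * cmod w"
        unfolding l_def by (metis abs_Re_le_cmod complex_mod_cnj norm_mult)
      also have "\<dots> \<le> M1 * cmod w"
        using M1(2)[of 0] by (intro mult_right_mono) auto
      finally show ?thesis .
    qed
    have deriv: "((\<lambda>t. l (F (q + t *\<^sub>R h))) has_real_derivative
        l (fst h *\<^sub>R F1 (q + t *\<^sub>R h) + snd h *\<^sub>R F2 (q + t *\<^sub>R h))) (at t)" for t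
      unfolding has_real_derivative_iff_has_vector_derivative
      by (rule bounded_linear.has_vector_derivative[OF l has_partials_line[OF hp(1)]])
    obtain t where t: "0 < t" "t < 1" "l (F (q + 1 *\<^sub>R h)) - l (F (q + 0 *\<^sub>R h)) =
        (1 - 0) * l (fst h *\<^sub>R F1 (q + t *\<^sub>R h) + snd h *\<^sub>R F2 (q + t *\<^sub>R h))"
      using MVT2[of 0 1, OF zero_less_one deriv] by blast
    define m where "m = q + t *\<^sub>R h"
    have m: "norm m < \<epsilon>"
      using segment[OF q(1) p(1), of t] t by (simp add: m_def h_def)
    have "c * fst h \<le> l (F1 m) * fst h"
      using \<epsilon>2(2)[of m] m \<epsilon> True
      by (intro mult_right_mono) (auto simp: l_def h_def dist_real_def abs_if split: if_splits)
    also have "\<dots> = l (fst h *\<^sub>R F1 m + snd h *\<^sub>R F2 m) - snd h * l (F2 m)"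
      using l by (simp add: linear_simps)
    also have "\<dots> = l (F p - F q) - snd h * l (F2 m)"
      using t l by (simp add: m_def h_def linear_simps)
    also have "\<dots> \<le> M1 * (2 * \<delta>) + \<delta> * (M1 * M2)"
    proof -
      have "l (F p - F q) \<le> M1 * cmod (F p - F q)"
        using l_le[of "F p - F q"] by simp
      also have "\<dots> \<le> M1 * (2 * \<delta>)"
        using norm_triangle_ineq4[of "F p - \<eta>" "F q - \<eta>"] p q M1 by (intro mult_left_mono) auto
      finally have 1: "l (F p - F q) \<le> M1 * (2 * \<delta>)" .
      have "- (snd h * l (F2 m)) \<le> \<bar>snd h\<bar> * \<bar>l (F2 m)\<bar>"
        by (metis abs_ge_minus_self abs_mult)
      also have "\<dots> \<le> \<delta> * (M1 * M2)"
      proof (intro mult_mono)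
        have "\<bar>l (F2 m)\<bar> \<le> M1 * cmod (F2 m)"
          by (rule l_le)
        also have "\<dots> \<le> M1 * M2"
          using M1 M2(2)[of m] m \<epsilon> by (intro mult_left_mono) auto
        finally show "\<bar>l (F2 m)\<bar> \<le> M1 * M2" .
        show "0 \<le> \<delta>"
          using snd by linarith
      qed (use snd h_def in auto)
      finally show ?thesis
        using 1 by simp
    qed
    finally have "fst h \<le> (M1 * (2 * \<delta>) + \<delta> * (M1 * M2)) / c"
      using c by (simp add: field_simps)
    also have "\<dots> = (2 * M1 + M1 * M2) / c * \<delta>"
      by (simp add: field_simps)
    finally show ?thesis
      by (simp add: h_def)
  qed

  \<comment> \<open>In order: 1 absorbs the \<theta>2-gap inside a cell, the quotient is the
    \<theta>1-bound, and the last entry counts occupied cells, using sqrt \<delta> \<le> 1.\<close>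
  define K where "K = max (max 1 ((2 * M1 + M1 * M2) / c)) (2 * sqrt (4 * M1 / \<kappa>) + 4)"
  show thesis
  proof
    show "\<epsilon> > 0" "K > 0"
      using \<epsilon> by (auto simp: K_def)
    fix \<eta> :: complex and \<delta> :: real
    assume \<delta>: "0 < \<delta>" "\<delta> \<le> 1"
    define E where "E = {p. norm p < \<epsilon> \<and> cmod (F p - \<eta>) < \<delta>}"
    define d where "d = sqrt (4 * M1 / \<kappa> * \<delta>)"
    define f where "f p = \<lfloor>snd p / \<delta>\<rfloor>" for p :: "real \<times> real"
    have "d \<ge> 0"
      using M1 \<kappa> \<delta> by (simp add: d_def)
    have "bounded (snd ` E)"
    proof (rule bounded_subset[OF bounded_cball])
      show "snd ` E \<subseteq> cball 0 \<epsilon>"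
      proof
        fix s
        assume "s \<in> snd ` E"
        then obtain p where p: "p \<in> E" "s = snd p"
          by blast
        have "\<bar>snd p\<bar> \<le> norm p"
          by (metis norm_snd_le prod.collapse real_norm_def)
        also have "\<dots> \<le> \<epsilon>"
          using p by (simp add: E_def)
        finally show "s \<in> cball 0 \<epsilon>"
          by (simp add: p)
      qed
    qed
    note fl = three_point_floor_card[OF this \<open>d \<ge> 0\<close> \<delta>(1)]
    have three: "s2 - s1 \<le> d \<or> s3 - s2 \<le> d"
      if sE: "s1 \<in> snd ` E" "s2 \<in> snd ` E" "s3 \<in> snd ` E" and ord: "s1 < s2" "s2 < s3" for s1 s2 s3
    proof -
      obtain p1 p2 p3 where p: "p1 \<in> E" "p2 \<in> E" "p3 \<in> E" and s: "s1 = snd p1" "s2 = snd p2" "s3 = snd p3"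
        using sE by blast
      show ?thesis
      \<comment> \<open>The \<theta>2-slope of the functional at the middle point has a sign; the
        neighbour on the side where the first-order term is nonpositive is the one that must be
        close.\<close>
      proof (cases "0 \<le> Re (\<i> * cnj (F1 p2) * F2 p2)")
        case True
        then have "Re (\<i> * cnj (F1 p2) * F2 p2) * (snd p1 - snd p2) \<le> 0"
          using ord s by (intro mult_nonneg_nonpos) auto
        then have "snd p2 - snd p1 \<le> d"
          unfolding d_def using one_sided[of p2 \<eta> \<delta> p1] p by (auto simp: E_def)
        then show ?thesis
          by (simp add: s)
      next
        case False
        then have "Re (\<i> * cnj (F1 p2) * F2 p2) * (snd p3 - snd p2) \<le> 0"
          using ord s by (intro mult_nonpos_nonneg) auto
        then have "snd p3 - snd p2 \<le> d"
          unfolding d_def using one_sided[of p2 \<eta> \<delta> p3] p by (auto simp: E_def)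
        then show ?thesis
          by (simp add: s)
      qed
    qed
    have fE: "f ` E = (\<lambda>s. \<lfloor>s / \<delta>\<rfloor>) ` snd ` E"
      by (simp add: f_def image_image)
    \<comment> \<open>One point of \<open>E\<close> per occupied \<theta>2-cell of width \<delta>.
      The \<theta>1-direction is left undivided, because \<open>fst_bound\<close> confines the
      points sharing a cell to a \<theta>1-range O(\<delta>).\<close>
    define T where "T = inv_into E f ` f ` E"
    have fin: "finite (f ` E)"
      using fl(1)[OF three] by (simp add: fE)
    have "real (card T) \<le> real (card (f ` E))"
      unfolding T_def using card_image_le[OF fin] by simp
    also have "\<dots> \<le> 2 * (d / \<delta> + 2)"
      using fl(2)[OF three] by (simp add: fE)
    also have "\<dots> = (2 * sqrt (4 * M1 / \<kappa>) + 4 * sqrt \<delta>) / sqrt \<delta>"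
    proof -
      have "d / \<delta> = sqrt (4 * M1 / \<kappa>) * sqrt \<delta> / (sqrt \<delta> * sqrt \<delta>)"
        unfolding d_def real_sqrt_mult[of "4 * M1 / \<kappa>" \<delta>] using \<delta> by simp
      also have "\<dots> = sqrt (4 * M1 / \<kappa>) / sqrt \<delta>"
        using \<delta> by (subst mult_divide_mult_cancel_right) auto
      finally have "2 * (d / \<delta> + 2) = 2 * sqrt (4 * M1 / \<kappa>) / sqrt \<delta> + 4"
        by simp
      moreover have "4 = 4 * sqrt \<delta> / sqrt \<delta>"
        using \<delta> by simp
      ultimately show ?thesis
        unfolding add_divide_distrib by linarith
    qed
    also have "\<dots> \<le> K / sqrt \<delta>"
      using \<delta> by (intro divide_right_mono) (auto simp: K_def le_max_iff_disj)
    finally have card: "real (card T) \<le> K / sqrt \<delta>" .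
    have near: "\<exists>t\<in>T. \<bar>fst p - fst t\<bar> \<le> K * \<delta> \<and> \<bar>snd p - snd t\<bar> \<le> K * \<delta>" if p: "p \<in> E" for p
    proof
      define t where "t = inv_into E f (f p)"
      show "t \<in> T"
        using p by (simp add: T_def t_def)
      have t: "t \<in> E" "f t = f p"
        using p by (auto simp: t_def inv_into_into f_inv_into_f)
      have "\<bar>snd p / \<delta> - snd t / \<delta>\<bar> \<le> 1"
        using t(2) unfolding f_def by linarith
      then have snd: "\<bar>snd p - snd t\<bar> \<le> \<delta>"
        using \<delta> by (simp add: field_simps flip: diff_divide_distrib)
      have "\<bar>fst p - fst t\<bar> \<le> (2 * M1 + M1 * M2) / c * \<delta>"
      proof (rule abs_leI)
        show "fst p - fst t \<le> (2 * M1 + M1 * M2) / c * \<delta>"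
          using p t snd by (intro fst_bound[where \<eta> = \<eta>]) (auto simp: E_def)
        have "fst t - fst p \<le> (2 * M1 + M1 * M2) / c * \<delta>"
          using p t snd by (intro fst_bound[where \<eta> = \<eta>]) (auto simp: E_def abs_minus_commute)
        then show "- (fst p - fst t) \<le> (2 * M1 + M1 * M2) / c * \<delta>"
          by simp
      qed
      also have "\<dots> \<le> K * \<delta>"
        using \<delta> by (intro mult_right_mono) (auto simp: K_def)
      finally have "\<bar>fst p - fst t\<bar> \<le> K * \<delta>" .
      moreover have "\<delta> \<le> K * \<delta>"
        using \<delta> by (simp add: K_def)
      ultimately show "\<bar>fst p - fst t\<bar> \<le> K * \<delta> \<and> \<bar>snd p - snd t\<bar> \<le> K * \<delta>"
        using snd by simp
    qed
    show "\<exists>T. finite T \<and> real (card T) \<le> K / sqrt \<delta> \<and>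
       (\<forall>p. norm p < \<epsilon> \<longrightarrow> cmod (F p - \<eta>) < \<delta> \<longrightarrow>
         (\<exists>t\<in>T. \<bar>fst p - fst t\<bar> \<le> K * \<delta> \<and> \<bar>snd p - snd t\<bar> \<le> K * \<delta>))"
    proof (intro exI conjI allI impI)
      show "finite T"
        using fin by (simp add: T_def)
    qed (use card near in \<open>auto simp: E_def\<close>)
  qed
qed

subsection \<open>The restriction to the torus\<close>

text \<open>The tangent direction of the torus rotates with the point, while \<open>Ck_on\<close>
  controls derivatives in fixed directions; the real basis separates the two. Off the open bidisc
  the smooth extension has only a real-linear derivative to start from.\<close>

lemma frechet_derivative_pair_expand:
  fixes G :: "complex \<times> complex \<Rightarrow> complex"
  assumes "G differentiable at x"
  shows "frechet_derivative G (at x) (v, w) =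
     Re v *\<^sub>R frechet_derivative G (at x) (1, 0) + Im v *\<^sub>R frechet_derivative G (at x) (\<i>, 0)
   + Re w *\<^sub>R frechet_derivative G (at x) (0, 1) + Im w *\<^sub>R frechet_derivative G (at x) (0, \<i>)"
proof -
  have lin: "linear (frechet_derivative G (at x))"
    using assms by (rule linear_frechet_derivative)
  have "(v, w) = Re v *\<^sub>R (1, 0) + Im v *\<^sub>R (\<i>, 0) + Re w *\<^sub>R (0, 1) + Im w *\<^sub>R (0, \<i>)"
    by (simp add: complex_eq_iff)
  then show ?thesis
    by (simp only: linear_add[OF lin] linear_scale[OF lin])
qed

text \<open>Chain rule with the tangent vector i e^(ia) = - sin a + i cos a. \<open>G\<close> is
  general because the rule is applied to \<phi> and again to its directional derivatives.\<close>

lemma torus_partials: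
  fixes G :: "complex \<times> complex \<Rightarrow> complex" and \<alpha>1 \<alpha>2 :: real
  defines "\<gamma> \<equiv> \<lambda>p. (cis (\<alpha>1 + fst p), cis (\<alpha>2 + snd p))"
  assumes diff: "\<And>x. x \<in> torus2 \<Longrightarrow> G differentiable at x"
  shows "has_partials (\<lambda>p. G (\<gamma> p))
     (\<lambda>p. (- sin (\<alpha>1 + fst p)) *\<^sub>R frechet_derivative G (at (\<gamma> p)) (1, 0)
         + cos (\<alpha>1 + fst p) *\<^sub>R frechet_derivative G (at (\<gamma> p)) (\<i>, 0))
     (\<lambda>p. (- sin (\<alpha>2 + snd p)) *\<^sub>R frechet_derivative G (at (\<gamma> p)) (0, 1)
         + cos (\<alpha>2 + snd p) *\<^sub>R frechet_derivative G (at (\<gamma> p)) (0, \<i>))"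
  unfolding has_partials_def
proof
  fix p :: "real \<times> real"
  have d: "G differentiable at (\<gamma> p)"
    by (rule diff) (simp add: \<gamma>_def torus2_def)
  have cis': "((\<lambda>p. cis (a + l p)) has_derivative (\<lambda>h. l h *\<^sub>R (\<i> * cis (a + l p)))) (at p)"
    if l: "bounded_linear l" for a :: real and l :: "real \<times> real \<Rightarrow> real"
  proof -
    have "((\<lambda>p. a + l p) has_derivative l) (at p)"
      using bounded_linear_imp_has_derivative[OF l] by (auto intro!: derivative_eq_intros)
    then show ?thesis
      by (rule has_derivative_cis)
  qed
  have "(\<gamma> has_derivative (\<lambda>h. (fst h *\<^sub>R (\<i> * cis (\<alpha>1 + fst p)), snd h *\<^sub>R (\<i> * cis (\<alpha>2 + snd p))))) (at p)"
    unfolding \<gamma>_def by (intro has_derivative_Pair cis' bounded_linear_fst bounded_linear_snd)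
  moreover have "(G has_derivative frechet_derivative G (at (\<gamma> p))) (at (\<gamma> p))"
    using d by (simp add: frechet_derivative_works)
  ultimately have "((\<lambda>p. G (\<gamma> p)) has_derivative (\<lambda>h. frechet_derivative G (at (\<gamma> p))
      (fst h *\<^sub>R (\<i> * cis (\<alpha>1 + fst p)), snd h *\<^sub>R (\<i> * cis (\<alpha>2 + snd p))))) (at p)"
    by (rule has_derivative_compose)
  then show "((\<lambda>p. G (\<gamma> p)) has_derivative
     (\<lambda>h. fst h *\<^sub>R ((- sin (\<alpha>1 + fst p)) *\<^sub>R frechet_derivative G (at (\<gamma> p)) (1, 0)
         + cos (\<alpha>1 + fst p) *\<^sub>R frechet_derivative G (at (\<gamma> p)) (\<i>, 0))
      + snd h *\<^sub>R ((- sin (\<alpha>2 + snd p)) *\<^sub>R frechet_derivative G (at (\<gamma> p)) (0, 1)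
         + cos (\<alpha>2 + snd p) *\<^sub>R frechet_derivative G (at (\<gamma> p)) (0, \<i>)))) (at p)"
    by (rule has_derivative_eq_rhs)
      (rule ext, subst (1) frechet_derivative_pair_expand[OF d], simp add: algebra_simps)
qed

text \<open>Product rule for the shape that \<open>torus_partials\<close> produces. The pair
  \<open>l1\<close>, \<open>l2\<close> is the constant gradient of the angle, in use (1, 0) or (0,
  1).\<close>

lemma has_partials_rotating:
  fixes \<theta> :: "real \<times> real \<Rightarrow> real"
  assumes A: "has_partials A A1 A2" "continuous_on UNIV A1" "continuous_on UNIV A2"
    and B: "has_partials B B1 B2" "continuous_on UNIV B1" "continuous_on UNIV B2"
    and \<theta>: "\<And>p. (\<theta> has_derivative (\<lambda>h. l1 * fst h + l2 * snd h)) (at p)"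
  obtains P1 P2 where "has_partials (\<lambda>p. (- sin (\<theta> p)) *\<^sub>R A p + cos (\<theta> p) *\<^sub>R B p) P1 P2"
    "continuous_on UNIV P1" "continuous_on UNIV P2"
proof
  have "continuous_on UNIV \<theta>"
    by (intro continuous_at_imp_continuous_on ballI has_derivative_continuous[OF \<theta>])
  note cont = this has_partials_continuous[OF A(1)] has_partials_continuous[OF B(1)]
  define P where "P l A1 B1 p = (- (l * cos (\<theta> p))) *\<^sub>R A p + (- sin (\<theta> p)) *\<^sub>R A1 p
      + (- (l * sin (\<theta> p))) *\<^sub>R B p + cos (\<theta> p) *\<^sub>R B1 p" for l :: real and A1 B1 :: "real \<times> real \<Rightarrow> complex" and p
  show "continuous_on UNIV (P l1 A1 B1)" "continuous_on UNIV (P l2 A2 B2)"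
    unfolding P_def by (intro continuous_intros cont A B)+
  show "has_partials (\<lambda>p. (- sin (\<theta> p)) *\<^sub>R A p + cos (\<theta> p) *\<^sub>R B p) (P l1 A1 B1) (P l2 A2 B2)"
    unfolding has_partials_def
  proof
    fix p
    have dA: "(A has_derivative (\<lambda>h. fst h *\<^sub>R A1 p + snd h *\<^sub>R A2 p)) (at p)"
      and dB: "(B has_derivative (\<lambda>h. fst h *\<^sub>R B1 p + snd h *\<^sub>R B2 p)) (at p)"
      using A(1) B(1) unfolding has_partials_def by blast+
    have ds: "((\<lambda>p. - sin (\<theta> p)) has_derivative (\<lambda>h. - (cos (\<theta> p) * (l1 * fst h + l2 * snd h)))) (at p)"
      and dc: "((\<lambda>p. cos (\<theta> p)) has_derivative (\<lambda>h. - (sin (\<theta> p) * (l1 * fst h + l2 * snd h)))) (at p)"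
      by (rule has_derivative_eq_rhs[OF has_derivative_minus[OF has_derivative_sin[OF \<theta>]]]
          has_derivative_eq_rhs[OF has_derivative_cos[OF \<theta>]], simp add: mult.commute)+
    show "((\<lambda>p. (- sin (\<theta> p)) *\<^sub>R A p + cos (\<theta> p) *\<^sub>R B p) has_derivative
        (\<lambda>h. fst h *\<^sub>R P l1 A1 B1 p + snd h *\<^sub>R P l2 A2 B2 p)) (at p)"
      by (rule has_derivative_eq_rhs[OF has_derivative_add[OF has_derivative_scaleR[OF ds dA]
              has_derivative_scaleR[OF dc dB]]])
        (simp add: P_def fun_eq_iff algebra_simps)
  qed
qed

text \<open>Two rounds of differentiation along the torus, with continuous second partials. The last
  clause records \<open>F1\<close> as a derivative in the tangential direction i e^(i(\<alpha>1 +
  \<theta>1)), the form to which complex linearity can be applied.\<close>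

lemma torus_C2:
  fixes \<phi> :: "complex \<times> complex \<Rightarrow> complex" and \<alpha>1 \<alpha>2 :: real
  assumes S: "torus2 \<subseteq> S" and \<phi>: "Ck_on 3 S \<phi>"
  defines "\<gamma> \<equiv> \<lambda>p. (cis (\<alpha>1 + fst p), cis (\<alpha>2 + snd p))"
  obtains F1 F2 F11 F12 F21 F22 where
    "has_partials (\<lambda>p. \<phi> (\<gamma> p)) F1 F2" "has_partials F1 F11 F12" "has_partials F2 F21 F22"
    "continuous_on UNIV F11" "continuous_on UNIV F12" "continuous_on UNIV F21" "continuous_on UNIV F22"
    "\<And>p. F1 p = frechet_derivative \<phi> (at (\<gamma> p)) (\<i> * cis (\<alpha>1 + fst p), 0)"
proof -
  define D where "D v x = frechet_derivative \<phi> (at x) v" for v x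
  have diff: "\<phi> differentiable at x" if "x \<in> S" for x
    using \<phi> that unfolding numeral_3_eq_3 Ck_on.simps by blast
  have diffD: "D v differentiable at x" if "x \<in> S" for v x
    using \<phi> that unfolding numeral_3_eq_3 Ck_on.simps D_def[abs_def] by blast
  have contDD: "continuous_on S (\<lambda>x. frechet_derivative (D v) (at x) w)" for v w
    using \<phi> unfolding numeral_3_eq_3 Ck_on.simps D_def[abs_def] by blast
  have \<gamma>: "continuous_on UNIV \<gamma>" "\<gamma> p \<in> torus2" for p
    unfolding \<gamma>_def by (auto intro!: continuous_intros simp: torus2_def)
  have contDD\<gamma>: "continuous_on UNIV (\<lambda>p. frechet_derivative (D v) (at (\<gamma> p)) w)" for v w
    by (rule continuous_on_compose2[OF contDD \<gamma>(1)]) (use \<gamma>(2) S in blast)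
  have partD: "\<exists>P1 P2. has_partials (\<lambda>p. D v (\<gamma> p)) P1 P2 \<and> continuous_on UNIV P1 \<and> continuous_on UNIV P2" for v
  proof (intro exI conjI)
    show "has_partials (\<lambda>p. D v (\<gamma> p))
     (\<lambda>p. (- sin (\<alpha>1 + fst p)) *\<^sub>R frechet_derivative (D v) (at (\<gamma> p)) (1, 0)
         + cos (\<alpha>1 + fst p) *\<^sub>R frechet_derivative (D v) (at (\<gamma> p)) (\<i>, 0))
     (\<lambda>p. (- sin (\<alpha>2 + snd p)) *\<^sub>R frechet_derivative (D v) (at (\<gamma> p)) (0, 1)
         + cos (\<alpha>2 + snd p) *\<^sub>R frechet_derivative (D v) (at (\<gamma> p)) (0, \<i>))"
      unfolding \<gamma>_def by (rule torus_partials) (use diffD S in blast)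
  qed (intro continuous_intros contDD\<gamma>)+
  define F1 where "F1 p = (- sin (\<alpha>1 + fst p)) *\<^sub>R D (1, 0) (\<gamma> p) + cos (\<alpha>1 + fst p) *\<^sub>R D (\<i>, 0) (\<gamma> p)" for p
  define F2 where "F2 p = (- sin (\<alpha>2 + snd p)) *\<^sub>R D (0, 1) (\<gamma> p) + cos (\<alpha>2 + snd p) *\<^sub>R D (0, \<i>) (\<gamma> p)" for p
  have 1: "has_partials (\<lambda>p. \<phi> (\<gamma> p)) F1 F2"
    unfolding F1_def F2_def D_def \<gamma>_def by (rule torus_partials) (use diff S in blast)
  have angle: "((\<lambda>p. \<alpha>1 + fst p) has_derivative (\<lambda>h. 1 * fst h + 0 * snd h)) (at p)"
    "((\<lambda>p. \<alpha>2 + snd p) has_derivative (\<lambda>h. 0 * fst h + 1 * snd h)) (at p)" for p :: "real \<times> real"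
    by (auto intro!: derivative_eq_intros)
  obtain A1 A2 where A: "has_partials (\<lambda>p. D (1, 0) (\<gamma> p)) A1 A2" "continuous_on UNIV A1" "continuous_on UNIV A2"
    using partD by blast
  obtain B1 B2 where B: "has_partials (\<lambda>p. D (\<i>, 0) (\<gamma> p)) B1 B2" "continuous_on UNIV B1" "continuous_on UNIV B2"
    using partD by blast
  obtain F11 F12 where 2: "has_partials F1 F11 F12" "continuous_on UNIV F11" "continuous_on UNIV F12"
    unfolding F1_def by (rule has_partials_rotating[OF A B angle(1)])
  obtain A1 A2 where A: "has_partials (\<lambda>p. D (0, 1) (\<gamma> p)) A1 A2" "continuous_on UNIV A1" "continuous_on UNIV A2"
    using partD by blast
  obtain B1 B2 where B: "has_partials (\<lambda>p. D (0, \<i>) (\<gamma> p)) B1 B2" "continuous_on UNIV B1" "continuous_on UNIV B2"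
    using partD by blast
  obtain F21 F22 where 3: "has_partials F2 F21 F22" "continuous_on UNIV F21" "continuous_on UNIV F22"
    unfolding F2_def by (rule has_partials_rotating[OF A B angle(2)])
  have "F1 p = frechet_derivative \<phi> (at (\<gamma> p)) (\<i> * cis (\<alpha>1 + fst p), 0)" for p
    using diff[of "\<gamma> p"] \<gamma>(2)[of p] S
    by (subst frechet_derivative_pair_expand) (auto simp: F1_def D_def)
  then show thesis
    by (rule that[OF 1 2(1) 3(1) 2(2,3) 3(2,3)])
qed

text \<open>Existence of the second derivative at 0 is given; the expansion identifies its value.
  Multiplying the quotient by t gives u'(0) = 0, and l'Hopital then compares (u(t) - u(0)) / t^2
  with u'(t) / (2 t).\<close>

lemma second_derivative_from_expansion:
  fixes u u' :: "real \<Rightarrow> real"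
  assumes u: "\<And>t. (u has_real_derivative u' t) (at t)" and u': "(u' has_real_derivative d) (at 0)"
    and lim: "((\<lambda>t. (u t - u 0) / t\<^sup>2) \<longlongrightarrow> - q) (at 0)"
  shows "u' 0 = 0" and "d = - 2 * q"
proof -
  have "((\<lambda>t. t * ((u t - u 0) / t\<^sup>2)) \<longlongrightarrow> 0 * (- q)) (at 0)"
    by (intro tendsto_intros lim)
  \<comment> \<open>Also valid at t = 0, where both sides are 0 by the convention for
    division.\<close>
  moreover have "(\<lambda>t. t * ((u t - u 0) / t\<^sup>2)) = (\<lambda>t. (u t - u 0) / t)"
    by (auto simp: fun_eq_iff power2_eq_square)
  ultimately have "((\<lambda>t. (u t - u 0) / t) \<longlongrightarrow> 0) (at 0)"
    by simp
  moreover have "((\<lambda>t. (u t - u 0) / t) \<longlongrightarrow> u' 0) (at 0)"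
    using u[of 0] by (simp add: has_field_derivative_iff)
  ultimately show u'0: "u' 0 = 0"
    using LIM_unique by blast
  have "((\<lambda>t. (u t - u 0) / t\<^sup>2) \<longlongrightarrow> d / 2) (at 0)"
  proof (rule lhopital[where f' = u' and g' = "\<lambda>t. 2 * t"])
    have "isCont u 0"
      using u[of 0] by (rule DERIV_isCont)
    then show "((\<lambda>t. u t - u 0) \<longlongrightarrow> 0) (at 0)"
      by (simp add: isCont_def LIM_zero)
    show "((\<lambda>t::real. t\<^sup>2) \<longlongrightarrow> 0) (at 0)"
      by (rule tendsto_eq_intros | simp)+
    show "\<forall>\<^sub>F t::real in at 0. t\<^sup>2 \<noteq> 0" "\<forall>\<^sub>F t::real in at 0. 2 * t \<noteq> 0"
      by (auto simp: eventually_at_filter)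
    show "\<forall>\<^sub>F t in at 0. ((\<lambda>t. u t - u 0) has_real_derivative u' t) (at t)"
      by (intro always_eventually allI) (auto intro!: derivative_eq_intros u)
    show "\<forall>\<^sub>F t::real in at 0. ((\<lambda>t. t\<^sup>2) has_real_derivative 2 * t) (at t)"
      by (intro always_eventually allI) (auto intro!: derivative_eq_intros)
    have "((\<lambda>t. (u' t - u' 0) / (t - 0)) \<longlongrightarrow> d) (at 0)"
      using u' by (simp add: has_field_derivative_iff)
    then have "((\<lambda>t. (u' t - u' 0) / (t - 0) / 2) \<longlongrightarrow> d / 2) (at 0)"
      by (intro tendsto_intros) auto
    then show "((\<lambda>t. u' t / (2 * t)) \<longlongrightarrow> d / 2) (at 0)"
      by (simp add: u'0 mult.commute)
  qed
  with lim have "d / 2 = - q"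
    using LIM_unique by blast
  then show "d = - 2 * q"
    by simp
qed

text \<open>Q and the squared norm are both homogeneous of degree 2, so powers of t cancel along a
  line. \<open>h \<noteq> 0\<close> keeps t h away from 0 for t \<noteq> 0, as the punctured filter
  requires.\<close>

lemma expansion_along_line:
  fixes R :: "real \<times> real \<Rightarrow> real"
  assumes o: "(\<lambda>\<theta>. R \<theta> - (1 - (a * (fst \<theta>)\<^sup>2 + 2 * b * fst \<theta> * snd \<theta> + c * (snd \<theta>)\<^sup>2))) \<in> o[at 0](\<lambda>\<theta>. (norm \<theta>)\<^sup>2)"
    and h: "h \<noteq> 0"
  shows "((\<lambda>t. (R (t *\<^sub>R h) - 1) / t\<^sup>2) \<longlongrightarrow> - (a * (fst h)\<^sup>2 + 2 * b * fst h * snd h + c * (snd h)\<^sup>2)) (at 0)"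
proof -
  define Q where "Q \<theta> = a * (fst \<theta>)\<^sup>2 + 2 * b * fst \<theta> * snd \<theta> + c * (snd \<theta>)\<^sup>2" for \<theta> :: "real \<times> real"
  have Q: "Q (t *\<^sub>R h) = t\<^sup>2 * Q h" for t
    by (simp add: Q_def power2_eq_square algebra_simps)
  have "((\<lambda>\<theta>. (R \<theta> - (1 - Q \<theta>)) / (norm \<theta>)\<^sup>2) \<longlongrightarrow> 0) (at 0)"
    using smalloD_tendsto[OF o] by (simp add: Q_def)
  moreover have "filterlim (\<lambda>t. t *\<^sub>R h) (at 0) (at 0)"
    unfolding filterlim_at using h
    by (auto simp: eventually_at_filter intro!: tendsto_eq_intros)
  ultimately have "((\<lambda>t. (R (t *\<^sub>R h) - (1 - Q (t *\<^sub>R h))) / (norm (t *\<^sub>R h))\<^sup>2) \<longlongrightarrow> 0) (at 0)"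
    by (rule filterlim_compose)
  then have "((\<lambda>t. (norm h)\<^sup>2 * ((R (t *\<^sub>R h) - (1 - Q (t *\<^sub>R h))) / (norm (t *\<^sub>R h))\<^sup>2) - Q h) \<longlongrightarrow> (norm h)\<^sup>2 * 0 - Q h) (at 0)"
    by (intro tendsto_intros)
  then have "((\<lambda>t. (R (t *\<^sub>R h) - 1) / t\<^sup>2) \<longlongrightarrow> (norm h)\<^sup>2 * 0 - Q h) (at 0)"
  proof (rule Lim_transform_eventually)
    show "\<forall>\<^sub>F t in at 0. (norm h)\<^sup>2 * ((R (t *\<^sub>R h) - (1 - Q (t *\<^sub>R h))) / (norm (t *\<^sub>R h))\<^sup>2) - Q h
        = (R (t *\<^sub>R h) - 1) / t\<^sup>2"
      using h by (simp add: eventually_at_filter Q power_mult_distrib field_simps)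
  qed
  then show ?thesis
    by (simp add: Q_def)
qed

text \<open>Each direction \<open>h\<close> is a one-variable problem for t |-> Re(\<mu> F(t h)).
  The expansion 1 - Q has no linear part, so the gradient vanishes at 0 and the Hessian is -2
  Q.\<close>

lemma hessian_from_expansion:
  assumes hp: "has_partials F F1 F2" "has_partials F1 F11 F12" "has_partials F2 F21 F22"
    and o: "(\<lambda>\<theta>. Re (\<mu> * F \<theta>) - (1 - (a * (fst \<theta>)\<^sup>2 + 2 * b * fst \<theta> * snd \<theta> + c * (snd \<theta>)\<^sup>2))) \<in> o[at 0](\<lambda>\<theta>. (norm \<theta>)\<^sup>2)"
    and F0: "\<mu> * F 0 = 1" and h: "h \<noteq> 0"
  shows "Re (\<mu> * (fst h *\<^sub>R F1 0 + snd h *\<^sub>R F2 0)) = 0"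
    and "Re (\<mu> * (fst h *\<^sub>R (fst h *\<^sub>R F11 0 + snd h *\<^sub>R F12 0) + snd h *\<^sub>R (fst h *\<^sub>R F21 0 + snd h *\<^sub>R F22 0)))
      = - 2 * (a * (fst h)\<^sup>2 + 2 * b * fst h * snd h + c * (snd h)\<^sup>2)"
proof -
  define l where "l w = Re (\<mu> * w)" for w
  have l: "bounded_linear l"
    unfolding l_def by (rule bounded_linear_compose[OF bounded_linear_Re bounded_linear_mult_right])
  have u: "((\<lambda>t. l (F (0 + t *\<^sub>R h))) has_real_derivative
      l (fst h *\<^sub>R F1 (0 + t *\<^sub>R h) + snd h *\<^sub>R F2 (0 + t *\<^sub>R h))) (at t)" for t
    unfolding has_real_derivative_iff_has_vector_derivative
    by (rule bounded_linear.has_vector_derivative[OF l has_partials_line[OF hp(1)]])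
  have u': "((\<lambda>t. l (fst h *\<^sub>R F1 (0 + t *\<^sub>R h) + snd h *\<^sub>R F2 (0 + t *\<^sub>R h))) has_real_derivative
      l (fst h *\<^sub>R (fst h *\<^sub>R F11 (0 + 0 *\<^sub>R h) + snd h *\<^sub>R F12 (0 + 0 *\<^sub>R h))
        + snd h *\<^sub>R (fst h *\<^sub>R F21 (0 + 0 *\<^sub>R h) + snd h *\<^sub>R F22 (0 + 0 *\<^sub>R h)))) (at 0)"
    unfolding has_real_derivative_iff_has_vector_derivative
    by (intro bounded_linear.has_vector_derivative[OF l] has_vector_derivative_add
        bounded_linear.has_vector_derivative[OF bounded_linear_scaleR_right]
        has_partials_line hp)
  have "((\<lambda>t. (l (F (0 + t *\<^sub>R h)) - l (F (0 + 0 *\<^sub>R h))) / t\<^sup>2)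
      \<longlongrightarrow> - (a * (fst h)\<^sup>2 + 2 * b * fst h * snd h + c * (snd h)\<^sup>2)) (at 0)"
    using expansion_along_line[OF o h] F0 by (simp add: l_def)
  from second_derivative_from_expansion[OF u u' this]
  show "Re (\<mu> * (fst h *\<^sub>R F1 0 + snd h *\<^sub>R F2 0)) = 0"
    and "Re (\<mu> * (fst h *\<^sub>R (fst h *\<^sub>R F11 0 + snd h *\<^sub>R F12 0) + snd h *\<^sub>R (fst h *\<^sub>R F21 0 + snd h *\<^sub>R F22 0)))
      = - 2 * (a * (fst h)\<^sup>2 + 2 * b * fst h * snd h + c * (snd h)\<^sup>2)"
    by (simp_all add: l_def)
qed

subsection \<open>Carleson boxes\<close>

text \<open>Lebesgue measure is determined by its values on boxes, and a complex box is the product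
  of its real and imaginary sides.\<close>

lemma lborel_complex_eq:
  "lborel = distr (lborel \<Otimes>\<^sub>M lborel) borel (\<lambda>(x, y). Complex x y)"
proof (rule lborel_eqI)
  have [measurable]: "(\<lambda>(x, y). Complex x y) \<in> borel_measurable (lborel \<Otimes>\<^sub>M lborel)"
    unfolding case_prod_unfold Complex_eq lborel_prod measurable_lborel2
    by (intro borel_measurable_continuous_onI continuous_intros)
  fix l u :: complex
  assume le: "\<And>b. b \<in> Basis \<Longrightarrow> l \<bullet> b \<le> u \<bullet> b"
  have lu: "Re l \<le> Re u" "Im l \<le> Im u"
    using le[of 1] le[of \<i>] by (auto simp: Basis_complex_def)
  have "(\<lambda>(x, y). Complex x y) -` box l u \<inter> space (lborel \<Otimes>\<^sub>M lborel)
      = {Re l<..<Re u} \<times> {Im l<..<Im u}"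
    by (auto simp: box_def Basis_complex_def space_pair_measure)
  then have "emeasure (distr (lborel \<Otimes>\<^sub>M lborel) borel (\<lambda>(x, y). Complex x y)) (box l u)
      = emeasure (lborel \<Otimes>\<^sub>M lborel) ({Re l<..<Re u} \<times> {Im l<..<Im u})"
    by (subst emeasure_distr) auto
  also have "\<dots> = ennreal (Re u - Re l) * ennreal (Im u - Im l)"
    using lu by (subst lborel.emeasure_pair_measure_Times) auto
  also have "\<dots> = (\<Prod>b\<in>Basis. (u - l) \<bullet> b)"
    using lu by (simp add: Basis_complex_def ennreal_mult)
  finally show "emeasure (distr (lborel \<Otimes>\<^sub>M lborel) borel (\<lambda>(x, y). Complex x y)) (box l u)
      = (\<Prod>b\<in>Basis. (u - l) \<bullet> b)" .
qed simp

text \<open>Both orders are kept: a Carleson box is integrated first in the direction transversal to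
  the circle, which is horizontal or vertical depending on the boundary point.\<close>

lemma nn_integral_lborel_complex:
  assumes [measurable]: "f \<in> borel_measurable borel"
  shows "(\<integral>\<^sup>+z. f z \<partial>lborel) = (\<integral>\<^sup>+x. \<integral>\<^sup>+y. f (Complex x y) \<partial>lborel \<partial>lborel)"
    and "(\<integral>\<^sup>+z. f z \<partial>lborel) = (\<integral>\<^sup>+y. \<integral>\<^sup>+x. f (Complex x y) \<partial>lborel \<partial>lborel)"
proof -
  have [measurable]: "(\<lambda>(x, y). Complex x y) \<in> borel_measurable (lborel \<Otimes>\<^sub>M lborel)"
    unfolding case_prod_unfold Complex_eq lborel_prod measurable_lborel2
    by (intro borel_measurable_continuous_onI continuous_intros)
  have [measurable]: "(\<lambda>(x, y). f (Complex x y)) \<in> borel_measurable (lborel \<Otimes>\<^sub>M lborel)"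
    by (measurable)
  have eq: "(\<integral>\<^sup>+z. f z \<partial>lborel) = (\<integral>\<^sup>+(x, y). f (Complex x y) \<partial>(lborel \<Otimes>\<^sub>M lborel))"
  proof -
    have "(\<integral>\<^sup>+z. f z \<partial>lborel) = (\<integral>\<^sup>+z. f z \<partial>distr (lborel \<Otimes>\<^sub>M lborel) borel (\<lambda>(x, y). Complex x y))"
      by (simp flip: lborel_complex_eq)
    also have "\<dots> = (\<integral>\<^sup>+p. f ((\<lambda>(x, y). Complex x y) p) \<partial>(lborel \<Otimes>\<^sub>M lborel))"
      by (rule nn_integral_distr) measurable
    finally show ?thesis
      by (simp add: case_prod_unfold)
  qed
  show "(\<integral>\<^sup>+z. f z \<partial>lborel) = (\<integral>\<^sup>+x. \<integral>\<^sup>+y. f (Complex x y) \<partial>lborel \<partial>lborel)"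
    unfolding eq by (subst lborel.nn_integral_fst[symmetric]) auto
  show "(\<integral>\<^sup>+z. f z \<partial>lborel) = (\<integral>\<^sup>+y. \<integral>\<^sup>+x. f (Complex x y) \<partial>lborel \<partial>lborel)"
    unfolding eq by (subst lborel_pair.nn_integral_snd[symmetric]) auto
qed

lemma nn_integral_powr_from_0:
  assumes "-1 < \<beta>" "0 \<le> c"
  shows "(\<integral>\<^sup>+s. ennreal (indicator {0..c} s * s powr \<beta>) \<partial>lborel) = ennreal (c powr (\<beta> + 1) / (\<beta> + 1))"
proof (rule nn_integral_has_integral_lborel)
  have "((\<lambda>s. if s \<in> {0..c} then s powr \<beta> else 0) has_integral c powr (\<beta> + 1) / (\<beta> + 1)) UNIV"
    using has_integral_powr_from_0[OF assms] by (subst has_integral_restrict_UNIV)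
  moreover have "(\<lambda>s. if s \<in> {0..c} then s powr \<beta> else 0) = (\<lambda>s. indicator {0..c} s * s powr \<beta>)"
    by (auto simp: indicator_def)
  ultimately show "((\<lambda>s. indicator {0..c} s * s powr \<beta>) has_integral c powr (\<beta> + 1) / (\<beta> + 1)) UNIV"
    by simp
qed auto

text \<open>With the half-chord X = sqrt(1 - y^2) \<ge> 3/5 one has 1 - x^2 - y^2 = (X - |x|) (X +
  |x|) \<ge> X (X - |x|). As \<beta> \<le> 0, the power is at most X^\<beta> s^\<beta> with s = X -
  |x| \<le> \<epsilon> / X. Integrating s^\<beta> brings the 1 / (\<beta> + 1) that cancels the
  normalization, so 4 serves for all \<beta>.\<close>

lemma chord_integral:
  fixes y :: real
  assumes \<beta>: "-1 < \<beta>" "\<beta> \<le> 0" and \<epsilon>: "\<epsilon> > 0" and y: "\<bar>y\<bar> \<le> 4/5"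
  shows "(\<integral>\<^sup>+x. ennreal (indicator {x. x\<^sup>2 + y\<^sup>2 < 1 \<and> 1 - (x\<^sup>2 + y\<^sup>2) \<le> \<epsilon>} x *
            ((\<beta> + 1) * (1 - (x\<^sup>2 + y\<^sup>2)) powr \<beta> / pi)) \<partial>lborel) \<le> ennreal (4 * \<epsilon> powr (\<beta> + 1))"
proof -
  define X where "X = sqrt (1 - y\<^sup>2)"
  have "y\<^sup>2 \<le> (4/5)\<^sup>2"
    using y by (intro power2_le_iff_abs_le[THEN iffD2]) auto
  then have y2: "y\<^sup>2 \<le> 16/25"
    by (simp add: power2_eq_square)
  have X2: "X\<^sup>2 = 1 - y\<^sup>2"
    using y2 by (simp add: X_def)
  have X: "X \<ge> 3/5"
    unfolding X_def using y2 by (intro real_le_rsqrt) (simp add: power2_eq_square)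
  define k where "k s = indicator {0..\<epsilon> / X} s * s powr \<beta>" for s :: real
  have k[measurable]: "k \<in> borel_measurable borel"
    unfolding k_def by measurable
  have k_nonneg: "k s \<ge> 0" for s
    by (simp add: k_def)
  define C where "C = (\<beta> + 1) / pi * X powr \<beta>"
  have C: "C \<ge> 0"
    using \<beta> by (simp add: C_def)
  have int_k: "(\<integral>\<^sup>+s. ennreal (k s) \<partial>lborel) = ennreal ((\<epsilon> / X) powr (\<beta> + 1) / (\<beta> + 1))"
    unfolding k_def using \<beta> \<epsilon> X by (intro nn_integral_powr_from_0) auto
  have shift: "(\<integral>\<^sup>+x. ennreal (k (X + a * x)) \<partial>lborel) = (\<integral>\<^sup>+s. ennreal (k s) \<partial>lborel)" if "\<bar>a\<bar> = 1" for a
    using that by (subst (2) nn_integral_real_affine[where c = a and t = X]) auto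
  have half: "(X\<^sup>2 - x\<^sup>2) powr \<beta> \<le> X powr \<beta> * k (X - x)"
    if x: "0 \<le> x" "x < X" "X\<^sup>2 - x\<^sup>2 \<le> \<epsilon>" for x
  proof -
    have "X * (X - x) \<le> (X + x) * (X - x)"
      using x by (intro mult_right_mono) auto
    also have "\<dots> = X\<^sup>2 - x\<^sup>2"
      by (simp add: power2_eq_square algebra_simps)
    finally have le: "X * (X - x) \<le> X\<^sup>2 - x\<^sup>2" .
    have "(X\<^sup>2 - x\<^sup>2) powr \<beta> \<le> (X * (X - x)) powr \<beta>"
      using le x X \<beta> by (intro powr_mono2') auto
    also have "\<dots> = X powr \<beta> * (X - x) powr \<beta>"
      using x X by (intro powr_mult)
    also have "(X - x) powr \<beta> = k (X - x)"
      using x X le by (auto simp: k_def indicator_def field_simps)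
    finally show ?thesis .
  qed
  \<comment> \<open>The sum over both chord ends dominates the contribution of the end nearest to x,
    which avoids splitting the integral at 0.\<close>
  have pointwise: "indicator {x. x\<^sup>2 + y\<^sup>2 < 1 \<and> 1 - (x\<^sup>2 + y\<^sup>2) \<le> \<epsilon>} x * ((\<beta> + 1) * (1 - (x\<^sup>2 + y\<^sup>2)) powr \<beta> / pi)
      \<le> C * (k (X + (-1) * x) + k (X + 1 * x))" for x
  proof (cases "x\<^sup>2 + y\<^sup>2 < 1 \<and> 1 - (x\<^sup>2 + y\<^sup>2) \<le> \<epsilon>")
    case False
    then have "indicator {x. x\<^sup>2 + y\<^sup>2 < 1 \<and> 1 - (x\<^sup>2 + y\<^sup>2) \<le> \<epsilon>} x = (0::real)"
      by simp
    then show ?thesis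
      using C k_nonneg by simp
  next
    case True
    then have x: "\<bar>x\<bar> < X" "X\<^sup>2 - \<bar>x\<bar>\<^sup>2 \<le> \<epsilon>"
      using X X2 by (auto intro: power_less_imp_less_base[of _ 2])
    have "(1 - (x\<^sup>2 + y\<^sup>2)) powr \<beta> = (X\<^sup>2 - \<bar>x\<bar>\<^sup>2) powr \<beta>"
      by (simp add: X2 algebra_simps)
    also have "\<dots> \<le> X powr \<beta> * k (X - \<bar>x\<bar>)"
      using x by (intro half) auto
    also have "\<dots> \<le> X powr \<beta> * (k (X + (-1) * x) + k (X + 1 * x))"
      using k_nonneg by (intro mult_left_mono) (auto simp: abs_if)
    finally have "(\<beta> + 1) / pi * (1 - (x\<^sup>2 + y\<^sup>2)) powr \<beta>
        \<le> (\<beta> + 1) / pi * (X powr \<beta> * (k (X + (-1) * x) + k (X + 1 * x)))"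
      using \<beta> by (intro mult_left_mono) auto
    then show ?thesis
      using True by (simp add: C_def mult.assoc)
  qed
  have "(\<integral>\<^sup>+x. ennreal (indicator {x. x\<^sup>2 + y\<^sup>2 < 1 \<and> 1 - (x\<^sup>2 + y\<^sup>2) \<le> \<epsilon>} x *
            ((\<beta> + 1) * (1 - (x\<^sup>2 + y\<^sup>2)) powr \<beta> / pi)) \<partial>lborel)
      \<le> (\<integral>\<^sup>+x. ennreal C * (ennreal (k (X + (-1) * x)) + ennreal (k (X + 1 * x))) \<partial>lborel)"
  proof (rule nn_integral_mono)
    fix x
    have "ennreal C * (ennreal (k (X + (-1) * x)) + ennreal (k (X + 1 * x)))
        = ennreal (C * (k (X + (-1) * x) + k (X + 1 * x)))"
      using C k_nonneg by (simp add: ennreal_mult)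
    with ennreal_leI[OF pointwise[of x]] show "ennreal (indicator {x. x\<^sup>2 + y\<^sup>2 < 1 \<and> 1 - (x\<^sup>2 + y\<^sup>2) \<le> \<epsilon>} x *
            ((\<beta> + 1) * (1 - (x\<^sup>2 + y\<^sup>2)) powr \<beta> / pi))
        \<le> ennreal C * (ennreal (k (X + (-1) * x)) + ennreal (k (X + 1 * x)))"
      by (simp only:)
  qed
  also have "\<dots> = ennreal C * ((\<integral>\<^sup>+x. ennreal (k (X + (-1) * x)) \<partial>lborel) + (\<integral>\<^sup>+x. ennreal (k (X + 1 * x)) \<partial>lborel))"
    by (subst nn_integral_cmult, measurable, subst nn_integral_add) auto
  also have "\<dots> = ennreal C * (ennreal ((\<epsilon> / X) powr (\<beta> + 1) / (\<beta> + 1)) + ennreal ((\<epsilon> / X) powr (\<beta> + 1) / (\<beta> + 1)))"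
    by (subst (1 2) shift) (auto simp: int_k)
  also have "\<dots> = ennreal (C * (2 * ((\<epsilon> / X) powr (\<beta> + 1) / (\<beta> + 1))))"
    using C \<beta> by (simp flip: ennreal_plus ennreal_mult)
  also have "C * (2 * ((\<epsilon> / X) powr (\<beta> + 1) / (\<beta> + 1))) = 2 / (pi * X) * \<epsilon> powr (\<beta> + 1)"
  proof -
    have "C * (2 * ((\<epsilon> / X) powr (\<beta> + 1) / (\<beta> + 1)))
        = (\<beta> + 1) / pi * X powr \<beta> * (2 * (\<epsilon> powr (\<beta> + 1) / (X powr \<beta> * X) / (\<beta> + 1)))"
      using X \<epsilon> by (simp add: C_def powr_divide powr_add[of X])
    also have "\<dots> = 2 / (pi * X) * \<epsilon> powr (\<beta> + 1)"
      using \<beta> X by (simp add: divide_simps)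
    finally show ?thesis .
  qed
  also have "ennreal (2 / (pi * X) * \<epsilon> powr (\<beta> + 1)) \<le> ennreal (4 * \<epsilon> powr (\<beta> + 1))"
  proof (intro ennreal_leI mult_right_mono)
    have "1 * (1/2) \<le> pi * X"
      using X pi_gt3 by (intro mult_mono) auto
    then show "2 / (pi * X) \<le> 4"
      by (simp add: field_simps)
  qed simp
  finally show ?thesis .
qed

lemma sets_dA_beta [simp, measurable_cong]: "sets (dA_beta \<beta>) = sets borel"
  by (simp add: dA_beta_def)

lemma dA_beta_density_measurable [measurable]:
  "(\<lambda>z. ennreal (indicator (ball 0 1) z * ((\<beta> + 1) * (1 - (cmod z)\<^sup>2) powr \<beta> / pi))) \<in> borel_measurable borel"
  by (intro measurable_compose[OF _ measurable_ennreal] borel_measurable_times borel_measurable_indicator) auto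

lemma sigma_finite_dA_beta: "sigma_finite_measure (dA_beta \<beta>)"
  unfolding dA_beta_def by (subst sigma_finite_measure.sigma_finite_iff_density_finite[OF lborel.sigma_finite_measure_axioms])
    (use dA_beta_density_measurable in simp_all)

text \<open>The angular side is measured in a Cartesian coordinate: where |co z| \<le> 4/5, lines of
  constant \<open>co\<close> cross the circle transversally, so integrating the chord bound over a
  band of width at most 2 r suffices. Hence 8 = 4 * 2.\<close>

lemma carleson_box:
  fixes s :: real
  assumes \<beta>: "-1 < \<beta>" "\<beta> \<le> 0" and \<epsilon>: "\<epsilon> > 0" and r: "r \<ge> 0" and co: "co = Re \<or> co = Im"
  defines "B \<equiv> {z. cmod z < 1 \<and> 1 - (cmod z)\<^sup>2 \<le> \<epsilon> \<and> \<bar>co z - s\<bar> \<le> r \<and> \<bar>co z\<bar> \<le> 4/5}"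
  shows "B \<in> sets borel" and "emeasure (dA_beta \<beta>) B \<le> ennreal (8 * r * \<epsilon> powr (\<beta> + 1))"
proof -
  have [measurable]: "co \<in> borel_measurable borel"
    using co by auto
  show B[measurable]: "B \<in> sets borel"
    unfolding B_def by measurable
  define J where "J = {s - r..s + r} \<inter> {-4/5..4/5::real}"
  define w where "w x y = ennreal (indicator {x. x\<^sup>2 + y\<^sup>2 < 1 \<and> 1 - (x\<^sup>2 + y\<^sup>2) \<le> \<epsilon>} x *
            ((\<beta> + 1) * (1 - (x\<^sup>2 + y\<^sup>2)) powr \<beta> / pi))" for x y
  have w_sym: "w x y = w y x" for x y
    by (simp add: w_def add.commute indicator_def)
  define f where "f z = ennreal (indicator (ball 0 1) z * ((\<beta> + 1) * (1 - (cmod z)\<^sup>2) powr \<beta> / pi)) * indicator B z" for z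
  have f[measurable]: "f \<in> borel_measurable borel"
    unfolding f_def by (intro borel_measurable_times_ennreal dA_beta_density_measurable borel_measurable_indicator B)
  have lt1: "sqrt (x\<^sup>2 + y\<^sup>2) < 1 \<longleftrightarrow> x\<^sup>2 + y\<^sup>2 < 1" for x y :: real
    by (simp add: real_sqrt_lt_1_iff)
  have f_Complex: "f (Complex x y) = indicator J (if co = Re then x else y) * w x y" for x y
    using co by (auto simp: f_def w_def B_def J_def indicator_def cmod_def lt1 abs_le_iff split: if_splits)
  have inner: "(\<integral>\<^sup>+x. indicator J y * w x y \<partial>lborel) \<le> ennreal (4 * \<epsilon> powr (\<beta> + 1)) * indicator J y" for y
  proof (cases "y \<in> J")
    case True
    then have "\<bar>y\<bar> \<le> 4/5"
      by (auto simp: J_def)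
    then show ?thesis
      using True chord_integral[OF \<beta> \<epsilon>, of y] by (simp add: w_def)
  qed simp
  have "emeasure (dA_beta \<beta>) B = (\<integral>\<^sup>+z. f z \<partial>lborel)"
    unfolding dA_beta_def f_def
    by (subst emeasure_density) (use B dA_beta_density_measurable in simp_all)
  also have "\<dots> = (\<integral>\<^sup>+y. \<integral>\<^sup>+x. indicator J y * w x y \<partial>lborel \<partial>lborel)"
  proof (cases "co = Re")
    case True
    then show ?thesis
      by (subst nn_integral_lborel_complex(1)) (auto simp: f_Complex w_sym)
  next
    case False
    then show ?thesis
      by (subst nn_integral_lborel_complex(2)) (auto simp: f_Complex)
  qed
  also have "\<dots> \<le> (\<integral>\<^sup>+y. ennreal (4 * \<epsilon> powr (\<beta> + 1)) * indicator J y \<partial>lborel)"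
    by (intro nn_integral_mono inner)
  also have "\<dots> = ennreal (4 * \<epsilon> powr (\<beta> + 1)) * emeasure lborel J"
    unfolding J_def by (subst nn_integral_cmult_indicator) auto
  also have "\<dots> \<le> ennreal (4 * \<epsilon> powr (\<beta> + 1)) * emeasure lborel {s - r..s + r}"
    unfolding J_def by (intro mult_left_mono emeasure_mono) auto
  also have "\<dots> = ennreal (8 * r * \<epsilon> powr (\<beta> + 1))"
    using r by (simp add: ac_simps flip: ennreal_mult)
  finally show "emeasure (dA_beta \<beta>) B \<le> ennreal (8 * r * \<epsilon> powr (\<beta> + 1))" .
qed

subsection \<open>Measure of sublevel sets near the torus\<close>

lemma norm_cis_diff_le: "cmod (cis a - cis b) \<le> \<bar>a - b\<bar>"
proof -
  have "cis a - cis b = cis b * (exp (\<i> * of_real (a - b)) - 1)"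
    by (simp only: cis_conv_exp[symmetric] right_diff_distrib cis_mult) simp
  then have "cmod (cis a - cis b) = 2 * \<bar>sin ((a - b) / 2)\<bar>"
    by (simp only: norm_mult norm_cis dist_exp_i_1 mult_1)
  also have "\<dots> \<le> 2 * \<bar>(a - b) / 2\<bar>"
    using abs_sin_x_le_abs_x[of "(a - b) / 2"] by (intro mult_left_mono) auto
  finally show ?thesis
    by simp
qed

text \<open>Dividing by \<xi> moves the question to the point 1, away from the branch cut of
  \<open>Arg\<close>; continuity there bounds the angle.\<close>

lemma polar_near:
  assumes \<xi>: "cmod \<xi> = 1" and e: "e > 0"
  obtains \<rho> where "\<rho> > 0"
    "\<And>z. dist z \<xi> < \<rho> \<Longrightarrow> \<exists>t. \<bar>t\<bar> < e \<and> z = of_real (cmod z) * (\<xi> * cis t)"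
proof -
  have "\<xi> \<noteq> 0"
    using \<xi> by auto
  have "isCont Arg 1"
    by (rule continuous_at_Arg) (simp add: complex_nonpos_Reals_iff)
  then obtain d where d: "d > 0" "\<And>w. dist w 1 < d \<Longrightarrow> \<bar>Arg w\<bar> < e"
    using e unfolding continuous_at_eps_delta by (auto simp: dist_real_def)
  show thesis
  proof
    show "d > 0"
      by fact
    fix z
    assume z: "dist z \<xi> < d"
    have "z / \<xi> - 1 = (z - \<xi>) / \<xi>"
      using \<open>\<xi> \<noteq> 0\<close> by (simp add: field_simps)
    then have "dist (z / \<xi>) 1 < d"
      using z by (simp add: dist_norm norm_divide \<xi>)
    then have "\<bar>Arg (z / \<xi>)\<bar> < e"
      by (rule d)
    moreover have "z = of_real (cmod z) * (\<xi> * cis (Arg (z / \<xi>)))"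
    proof -
      have "z / \<xi> = of_real (cmod (z / \<xi>)) * cis (Arg (z / \<xi>))"
        by (metis rcis_cmod_Arg rcis_def)
      then show ?thesis
        using \<open>\<xi> \<noteq> 0\<close> by (simp add: norm_divide \<xi> field_simps)
    qed
    ultimately show "\<exists>t. \<bar>t\<bar> < e \<and> z = of_real (cmod z) * (\<xi> * cis t)"
      by blast
  qed
qed

text \<open>Continuity of the derivative is given per direction, so it is bounded for each basis
  vector on the compact bidisc and the bounds are summed, with 1 added to make \<open>L\<close>
  positive. Convexity then allows the mean value inequality.\<close>

lemma C1_imp_lipschitz_on_closed_bidisc:
  fixes \<phi> :: "complex \<times> complex \<Rightarrow> complex"
  assumes diff: "\<And>x. x \<in> closed_bidisc \<Longrightarrow> \<phi> differentiable (at x)"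
    and cont: "\<And>v. continuous_on closed_bidisc (\<lambda>x. frechet_derivative \<phi> (at x) v)"
  obtains L where "L > 0"
    "\<And>x y. x \<in> closed_bidisc \<Longrightarrow> y \<in> closed_bidisc \<Longrightarrow> cmod (\<phi> x - \<phi> y) \<le> L * norm (x - y)"
proof -
  have comp: "compact closed_bidisc" and conv: "convex closed_bidisc"
    unfolding closed_bidisc_def by (intro compact_Times compact_cball, intro convex_Times convex_cball)
  have "\<exists>M. \<forall>x\<in>closed_bidisc. cmod (frechet_derivative \<phi> (at x) v) \<le> M" for v
    using compact_imp_bounded[OF compact_continuous_image[OF cont comp]]
    by (auto simp: bounded_iff)
  then obtain M where M: "\<And>v x. x \<in> closed_bidisc \<Longrightarrow> cmod (frechet_derivative \<phi> (at x) v) \<le> M v"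
    by metis
  define L where "L = (\<Sum>b\<in>Basis. \<bar>M b\<bar>) + 1"
  have L: "L > 0"
    unfolding L_def by (intro add_nonneg_pos sum_nonneg) auto
  have onorm: "onorm (frechet_derivative \<phi> (at x)) \<le> L" if x: "x \<in> closed_bidisc" for x
  proof (rule onorm_le)
    fix h :: "complex \<times> complex"
    have lin: "linear (frechet_derivative \<phi> (at x))"
      by (rule linear_frechet_derivative[OF diff[OF x]])
    have "frechet_derivative \<phi> (at x) h = frechet_derivative \<phi> (at x) (\<Sum>b\<in>Basis. (h \<bullet> b) *\<^sub>R b)"
      by (simp only: euclidean_representation)
    also have "\<dots> = (\<Sum>b\<in>Basis. (h \<bullet> b) *\<^sub>R frechet_derivative \<phi> (at x) b)"
      by (simp only: linear_sum[OF lin] linear_scale[OF lin])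
    also have "cmod \<dots> \<le> (\<Sum>b\<in>Basis. norm h * \<bar>M b\<bar>)"
    proof (rule sum_norm_le)
      fix b :: "complex \<times> complex"
      assume "b \<in> Basis"
      then show "cmod ((h \<bullet> b) *\<^sub>R frechet_derivative \<phi> (at x) b) \<le> norm h * \<bar>M b\<bar>"
        unfolding norm_scaleR using M[OF x, of b]
        by (intro mult_mono Basis_le_norm) auto
    qed
    also have "\<dots> \<le> L * norm h"
      by (simp add: L_def algebra_simps flip: sum_distrib_left)
    finally show "cmod (frechet_derivative \<phi> (at x) h) \<le> L * norm h" .
  qed
  show thesis
  proof
    show "L > 0"
      by fact
    show "cmod (\<phi> x - \<phi> y) \<le> L * norm (x - y)" if "x \<in> closed_bidisc" "y \<in> closed_bidisc" for x y
    proof (rule differentiable_bound[OF conv _ onorm])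
      show "(\<phi> has_derivative frechet_derivative \<phi> (at x)) (at x within closed_bidisc)" if "x \<in> closed_bidisc" for x
        using diff[OF that] by (simp add: frechet_derivative_works has_derivative_at_withinI)
    qed (use that in auto)
  qed
qed

lemma V_beta_rectangle:
  assumes "A \<in> sets borel" "B \<in> sets borel"
  shows "A \<times> B \<in> sets (V_beta \<beta>)" and "emeasure (V_beta \<beta>) (A \<times> B) = emeasure (dA_beta \<beta>) A * emeasure (dA_beta \<beta>) B"
proof -
  interpret sigma_finite_measure "dA_beta \<beta>"
    by (rule sigma_finite_dA_beta)
  show "A \<times> B \<in> sets (V_beta \<beta>)"
    unfolding V_beta_def using assms by simp
  show "emeasure (V_beta \<beta>) (A \<times> B) = emeasure (dA_beta \<beta>) A * emeasure (dA_beta \<beta>) B"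
    unfolding V_beta_def using assms by (intro emeasure_pair_measure_Times) auto
qed

text \<open>Both coordinates above 3/4 in modulus would give |\<xi>|^2 > 9/8. Stopping at 3/4 leaves
  room 1/20 below the 4/5 of the Carleson boxes.\<close>

lemma Re_or_Im_away_from_1:
  assumes "cmod \<xi> = 1"
  obtains co where "co = Re \<or> co = Im" "\<bar>co \<xi>\<bar> \<le> 3/4" "\<And>z w. \<bar>co z - co w\<bar> \<le> cmod (z - w)"
proof -
  have "\<bar>Re \<xi>\<bar> \<le> 3/4 \<or> \<bar>Im \<xi>\<bar> \<le> 3/4"
  proof (rule ccontr)
    assume "\<not> ?thesis"
    then have "(3/4)\<^sup>2 < \<bar>Re \<xi>\<bar>\<^sup>2" "(3/4)\<^sup>2 < \<bar>Im \<xi>\<bar>\<^sup>2"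
      by (intro power_strict_mono; simp)+
    moreover have "(Re \<xi>)\<^sup>2 + (Im \<xi>)\<^sup>2 = 1"
      using assms by (simp flip: cmod_power2)
    ultimately show False
      by (simp add: power2_eq_square)
  qed
  then show thesis
    using that[of Re] that[of Im] abs_Re_le_cmod abs_Im_le_cmod by (auto simp flip: minus_complex.sel)
qed

text \<open>The hypotheses isolate what the measure estimate takes from \<phi>: Lipschitz
  continuity, the Hopf bound in both variables and the cover on the torus. None of \<open>L\<close>,
  \<open>c\<close>, \<open>K\<close> involves \<beta>, \<eta> or \<delta>, which makes
  \<open>C\<close> uniform.\<close>

lemma sublevel_measure_bound:
  fixes \<phi> :: "complex \<times> complex \<Rightarrow> complex"
  assumes \<xi>: "cmod \<xi>1 = 1" "cmod \<xi>2 = 1"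
    and lip: "L > 0" "\<And>x y. x \<in> closed_bidisc \<Longrightarrow> y \<in> closed_bidisc \<Longrightarrow> cmod (\<phi> x - \<phi> y) \<le> L * norm (x - y)"
    and hopf: "c > 0" "\<rho> > 0"
      "\<And>z. z \<in> bidisc \<Longrightarrow> dist z (\<xi>1, \<xi>2) < \<rho> \<Longrightarrow>
        c * (1 - cmod (fst z)) \<le> 1 - cmod (\<phi> z) \<and> c * (1 - cmod (snd z)) \<le> 1 - cmod (\<phi> z)"
    and cover: "\<epsilon> > 0" "K > 0"
      "\<And>\<eta> \<delta>. 0 < \<delta> \<Longrightarrow> \<delta> \<le> 1 \<Longrightarrow> \<exists>T. finite T \<and> real (card T) \<le> K / sqrt \<delta> \<and>
        (\<forall>p. norm p < \<epsilon> \<longrightarrow> cmod (\<phi> (\<xi>1 * cis (fst p), \<xi>2 * cis (snd p)) - \<eta>) < \<delta> \<longrightarrow>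
          (\<exists>t\<in>T. \<bar>fst p - fst t\<bar> \<le> K * \<delta> \<and> \<bar>snd p - snd t\<bar> \<le> K * \<delta>))"
  shows "\<exists>U C. open U \<and> (\<xi>1, \<xi>2) \<in> U \<and> C > 0 \<and>
           (\<forall>\<beta>\<in>{-1<..0}. \<forall>\<eta>\<in>sphere (0::complex) 1. \<forall>\<delta>>0.
              emeasure (V_beta \<beta>) {z \<in> bidisc \<inter> U. cmod (\<phi> z - \<eta>) < \<delta>}
                \<le> ennreal (C * \<delta> powr (2 + \<beta> + 1/2)))"
proof -
  obtain co1 where co1: "co1 = Re \<or> co1 = Im" "\<bar>co1 \<xi>1\<bar> \<le> 3/4" "\<And>z w. \<bar>co1 z - co1 w\<bar> \<le> cmod (z - w)"
    using Re_or_Im_away_from_1[OF \<xi>(1)] by blast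
  obtain co2 where co2: "co2 = Re \<or> co2 = Im" "\<bar>co2 \<xi>2\<bar> \<le> 3/4" "\<And>z w. \<bar>co2 z - co2 w\<bar> \<le> cmod (z - w)"
    using Re_or_Im_away_from_1[OF \<xi>(2)] by blast
  have e2: "\<epsilon> / 2 > 0"
    using cover by simp
  obtain \<rho>1 where \<rho>1: "\<rho>1 > 0" "\<And>z. dist z \<xi>1 < \<rho>1 \<Longrightarrow> \<exists>t. \<bar>t\<bar> < \<epsilon> / 2 \<and> z = of_real (cmod z) * (\<xi>1 * cis t)"
    using polar_near[OF \<xi>(1) e2] by blast
  obtain \<rho>2 where \<rho>2: "\<rho>2 > 0" "\<And>z. dist z \<xi>2 < \<rho>2 \<Longrightarrow> \<exists>t. \<bar>t\<bar> < \<epsilon> / 2 \<and> z = of_real (cmod z) * (\<xi>2 * cis t)"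
    using polar_near[OF \<xi>(2) e2] by blast
  \<comment> \<open>The entry 1/20 is the room between 3/4 and 4/5, so that both chosen coordinates
    stay within 4/5 on \<open>U\<close>.\<close>
  define r where "r = Min {\<rho>, \<rho>1, \<rho>2, 1/20}"
  have r: "r > 0" "r \<le> \<rho>" "r \<le> \<rho>1" "r \<le> \<rho>2" "r \<le> 1/20"
    using hopf \<rho>1 \<rho>2 by (auto simp: r_def)
  define U where "U = ball (\<xi>1, \<xi>2) r"
  have U_dist: "dist (fst z) \<xi>1 < r" "dist (snd z) \<xi>2 < r" if "z \<in> U" for z
    using that dist_fst_le[of z "(\<xi>1, \<xi>2)"] dist_snd_le[of z "(\<xi>1, \<xi>2)"] by (auto simp: U_def dist_commute)
  have U_co: "\<bar>co1 (fst z) - co1 \<xi>1\<bar> \<le> 1/20" "\<bar>co2 (snd z) - co2 \<xi>2\<bar> \<le> 1/20"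
    "\<bar>co1 (fst z)\<bar> \<le> 4/5" "\<bar>co2 (snd z)\<bar> \<le> 4/5" if "z \<in> U" for z
    using U_dist[OF that] r co1(2) co1(3)[of "fst z" \<xi>1] co2(2) co2(3)[of "snd z" \<xi>2]
    by (auto simp: dist_norm)
  define B where "B co s \<epsilon> r = {z. cmod z < 1 \<and> 1 - (cmod z)\<^sup>2 \<le> \<epsilon> \<and> \<bar>co z - s\<bar> \<le> r \<and> \<bar>co z\<bar> \<le> 4/5}"
    for co :: "complex \<Rightarrow> real" and s \<epsilon> r :: real
  have B_borel: "B co s e r \<in> sets borel" if "co = Re \<or> co = Im" for co s e r
  proof -
    have [measurable]: "co \<in> borel_measurable borel"
      using that by auto
    show ?thesis
      unfolding B_def by measurable
  qed
  have V_B: "B co s e r \<times> B co' s' e r \<in> sets (V_beta \<beta>)"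
    "emeasure (V_beta \<beta>) (B co s e r \<times> B co' s' e r) \<le> ennreal ((8 * r * e powr (\<beta> + 1))\<^sup>2)"
    if "-1 < \<beta>" "\<beta> \<le> 0" "e > 0" "r \<ge> 0" "co = Re \<or> co = Im" "co' = Re \<or> co' = Im" for co co' s s' e r \<beta>
  proof -
    note borel = B_borel[OF that(5), of s e r] B_borel[OF that(6), of s' e r]
    show "B co s e r \<times> B co' s' e r \<in> sets (V_beta \<beta>)"
      by (rule V_beta_rectangle(1)[OF borel])
    have "emeasure (V_beta \<beta>) (B co s e r \<times> B co' s' e r)
        = emeasure (dA_beta \<beta>) (B co s e r) * emeasure (dA_beta \<beta>) (B co' s' e r)"
      by (rule V_beta_rectangle(2)[OF borel])
    also have "\<dots> \<le> ennreal (8 * r * e powr (\<beta> + 1)) * ennreal (8 * r * e powr (\<beta> + 1))"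
      unfolding B_def by (intro mult_mono carleson_box(2) that) auto
    also have "\<dots> = ennreal ((8 * r * e powr (\<beta> + 1))\<^sup>2)"
      using that by (simp add: power2_eq_square flip: ennreal_mult)
    finally show "emeasure (V_beta \<beta>) (B co s e r \<times> B co' s' e r) \<le> ennreal ((8 * r * e powr (\<beta> + 1))\<^sup>2)" .
  qed

  \<comment> \<open>Projecting radially to the torus enlarges \<delta> by the factor
    \<open>K1\<close>. \<open>R\<close> adds the angular error K K1 and the radial error 1 / c.
    \<open>m\<close> dominates (2 / c)^(\<beta> + 1) for every \<beta> in (-1, 0]. In
    \<open>C\<close>, 64 = 8^2 stems from the two boxes of a product, and K1^3 settles large
    \<delta>.\<close>
  define K1 where "K1 = 1 + 2 * L / c"
  define R where "R = K * K1 + 1 / c"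
  define m where "m = max 1 (2 / c)"
  define C where "C = 64 * K * R\<^sup>2 * m\<^sup>2 + K1 ^ 3"
  have K1: "K1 \<ge> 1"
    using lip hopf by (simp add: K1_def)
  have R: "R > 0"
    using cover K1 hopf by (auto simp: R_def intro!: add_pos_pos)
  have C: "C > 0" "64 * K * R\<^sup>2 * m\<^sup>2 \<le> C" "K1 ^ 3 \<le> C"
    using cover K1 by (auto simp: C_def intro!: add_nonneg_pos)

  have bound: "emeasure (V_beta \<beta>) {z \<in> bidisc \<inter> U. cmod (\<phi> z - \<eta>) < \<delta>} \<le> ennreal (C * \<delta> powr (2 + \<beta> + 1/2))"
    if \<beta>: "-1 < \<beta>" "\<beta> \<le> 0" and \<eta>: "cmod \<eta> = 1" and \<delta>: "\<delta> > 0" for \<beta> \<eta> \<delta>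
  proof -
    define E where "E = {z \<in> bidisc \<inter> U. cmod (\<phi> z - \<eta>) < \<delta>}"
    show ?thesis
    proof (cases "K1 * \<delta> \<le> 1")
      case False
      \<comment> \<open>For large \<delta> it is enough to measure \<open>U\<close>: depth 1 is no
        restriction inside the disc, the product of the two boxes has measure at most 1, and (K1
        \<delta>)^(5/2 + \<beta>) \<ge> 1.\<close>
      have "E \<subseteq> B co1 (co1 \<xi>1) 1 (1/20) \<times> B co2 (co2 \<xi>2) 1 (1/20)"
        using U_co by (auto simp: E_def B_def bidisc_def)
      then have "emeasure (V_beta \<beta>) E \<le> emeasure (V_beta \<beta>) (B co1 (co1 \<xi>1) 1 (1/20) \<times> B co2 (co2 \<xi>2) 1 (1/20))"
        by (intro emeasure_mono V_B \<beta> co1 co2) auto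
      also have "\<dots> \<le> ennreal ((8 * (1/20) * 1 powr (\<beta> + 1))\<^sup>2)"
        by (intro V_B \<beta> co1 co2) auto
      also have "\<dots> \<le> ennreal (C * \<delta> powr (2 + \<beta> + 1/2))"
      proof (rule ennreal_leI)
        have "(8 * (1/20) * 1 powr (\<beta> + 1))\<^sup>2 \<le> (1::real)"
          by (simp add: power2_eq_square)
        also have "1 \<le> (K1 * \<delta>) powr (2 + \<beta> + 1/2)"
          using False \<beta> by (intro ge_one_powr_ge_zero) auto
        also have "\<dots> = K1 powr (2 + \<beta> + 1/2) * \<delta> powr (2 + \<beta> + 1/2)"
          using K1 \<delta> by (simp add: powr_mult)
        also have "\<dots> \<le> C * \<delta> powr (2 + \<beta> + 1/2)"
        proof (intro mult_right_mono)
          have "K1 powr (2 + \<beta> + 1/2) \<le> K1 powr 3"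
            using K1 \<beta> by (intro powr_mono) auto
          also have "\<dots> = K1 ^ 3"
            using K1 by (simp add: powr_numeral)
          also have "\<dots> \<le> C"
            by (rule C)
          finally show "K1 powr (2 + \<beta> + 1/2) \<le> C" .
        qed simp
        finally show "(8 * (1/20) * 1 powr (\<beta> + 1))\<^sup>2 \<le> C * \<delta> powr (2 + \<beta> + 1/2)" .
      qed
      finally show ?thesis
        by (simp add: E_def)
    next
      case True
      have K1\<delta>: "0 < K1 * \<delta>"
        using K1 \<delta> by simp
      obtain T where T: "finite T" "real (card T) \<le> K / sqrt (K1 * \<delta>)"
        "\<And>p. norm p < \<epsilon> \<Longrightarrow> cmod (\<phi> (\<xi>1 * cis (fst p), \<xi>2 * cis (snd p)) - \<eta>) < K1 * \<delta> \<Longrightarrow>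
          \<exists>t\<in>T. \<bar>fst p - fst t\<bar> \<le> K * (K1 * \<delta>) \<and> \<bar>snd p - snd t\<bar> \<le> K * (K1 * \<delta>)"
        using cover(3)[OF K1\<delta> True, of \<eta>] by blast
      define W where "W t = B co1 (co1 (\<xi>1 * cis (fst t))) (2 / c * \<delta>) (R * \<delta>)
          \<times> B co2 (co2 (\<xi>2 * cis (snd t))) (2 / c * \<delta>) (R * \<delta>)" for t :: "real \<times> real"
      have "E \<subseteq> (\<Union>t\<in>T. W t)"
      proof
        fix z
        assume z: "z \<in> E"
        define z1 z2 where "z1 = fst z" and "z2 = snd z"
        have z_eq: "z = (z1, z2)"
          by (simp add: z1_def z2_def)
        have zU: "z \<in> U" and zD: "z \<in> bidisc" and z\<eta>: "cmod (\<phi> z - \<eta>) < \<delta>"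
          using z by (auto simp: E_def)
        have lt1: "cmod z1 < 1" "cmod z2 < 1"
          using zD by (auto simp: bidisc_def z_eq)
        have "dist z (\<xi>1, \<xi>2) < \<rho>"
          using zU r by (auto simp: U_def dist_commute)
        then have "c * (1 - cmod z1) \<le> 1 - cmod (\<phi> z)" "c * (1 - cmod z2) \<le> 1 - cmod (\<phi> z)"
          using hopf(3)[OF zD] by (auto simp: z1_def z2_def)
        \<comment> \<open>Here |\<eta>| = 1 enters: closeness to \<eta> forces |\<phi> z| \<ge> 1 -
          \<delta>, which the Hopf bound turns into depth at most \<delta> / c in each
          variable.\<close>
        moreover have "1 - cmod (\<phi> z) \<le> \<delta>"
          using norm_triangle_ineq2[of \<eta> "\<phi> z"] z\<eta> \<eta> by (simp add: norm_minus_commute)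
        ultimately have "c * (1 - cmod z1) \<le> \<delta>" "c * (1 - cmod z2) \<le> \<delta>"
          by linarith+
        then have depth: "1 - cmod z1 \<le> \<delta> / c" "1 - cmod z2 \<le> \<delta> / c"
          using hopf(1) by (simp_all add: field_simps)
        have depth2: "1 - (cmod w)\<^sup>2 \<le> 2 / c * \<delta>" if "cmod w < 1" "1 - cmod w \<le> \<delta> / c" for w
        proof -
          have "1 - (cmod w)\<^sup>2 = (1 + cmod w) * (1 - cmod w)"
            by (simp add: power2_eq_square algebra_simps)
          also have "\<dots> \<le> 2 * (\<delta> / c)"
            using that by (intro mult_mono) auto
          finally show ?thesis
            by simp
        qed
        obtain t1 where t1: "\<bar>t1\<bar> < \<epsilon> / 2" "z1 = of_real (cmod z1) * (\<xi>1 * cis t1)"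
          using \<rho>1(2)[of z1] U_dist[OF zU] r unfolding z1_def by fastforce
        obtain t2 where t2: "\<bar>t2\<bar> < \<epsilon> / 2" "z2 = of_real (cmod z2) * (\<xi>2 * cis t2)"
          using \<rho>2(2)[of z2] U_dist[OF zU] r unfolding z2_def by fastforce
        have radial: "cmod (\<zeta> * cis t - w) \<le> \<delta> / c"
          if "cmod \<zeta> = 1" "w = of_real (cmod w) * (\<zeta> * cis t)" "cmod w < 1" "1 - cmod w \<le> \<delta> / c" for w \<zeta> t
        proof -
          have "\<zeta> * cis t - w = of_real (1 - cmod w) * (\<zeta> * cis t)"
            by (subst that(2)) (simp add: algebra_simps)
          then have "cmod (\<zeta> * cis t - w) = \<bar>1 - cmod w\<bar>"
            by (simp only: norm_mult norm_of_real norm_cis that(1) mult_1_right)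
          then show ?thesis
            using that by simp
        qed
        note rad1 = radial[OF \<xi>(1) t1(2) lt1(1) depth(1)] and rad2 = radial[OF \<xi>(2) t2(2) lt1(2) depth(2)]
        \<comment> \<open>The point on the torus is the radial projection of \<open>z\<close>; the
          Lipschitz bound carries the sublevel condition there at the price of 2 L \<delta> /
          c.\<close>
        have "cmod (\<phi> (\<xi>1 * cis t1, \<xi>2 * cis t2) - \<phi> z) \<le> L * norm ((\<xi>1 * cis t1, \<xi>2 * cis t2) - z)"
          by (rule lip(2)) (use \<xi> lt1 in \<open>auto simp: closed_bidisc_def z_eq norm_mult\<close>)
        also have "\<dots> \<le> L * (\<delta> / c + \<delta> / c)"
          using lip(1) rad1 rad2 norm_Pair_le[of "\<xi>1 * cis t1 - z1" "\<xi>2 * cis t2 - z2"]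
          by (intro mult_left_mono) (auto simp: z_eq)
        finally have "cmod (\<phi> (\<xi>1 * cis t1, \<xi>2 * cis t2) - \<phi> z) \<le> 2 * L / c * \<delta>"
          by (simp add: algebra_simps)
        moreover have "cmod (\<phi> (\<xi>1 * cis t1, \<xi>2 * cis t2) - \<eta>)
            \<le> cmod (\<phi> (\<xi>1 * cis t1, \<xi>2 * cis t2) - \<phi> z) + cmod (\<phi> z - \<eta>)"
          using norm_triangle_ineq[of "\<phi> (\<xi>1 * cis t1, \<xi>2 * cis t2) - \<phi> z" "\<phi> z - \<eta>"] by simp
        ultimately have F: "cmod (\<phi> (\<xi>1 * cis t1, \<xi>2 * cis t2) - \<eta>) < K1 * \<delta>"
          using z\<eta> by (simp add: K1_def algebra_simps)
        have "norm (t1, t2) < \<epsilon>"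
          using norm_Pair_le[of t1 t2] t1 t2 by simp
        then obtain t where t: "t \<in> T" "\<bar>t1 - fst t\<bar> \<le> K * (K1 * \<delta>)" "\<bar>t2 - snd t\<bar> \<le> K * (K1 * \<delta>)"
          using T(3)[of "(t1, t2)"] F by auto
        have co_near: "\<bar>co w - co (\<zeta> * cis s')\<bar> \<le> R * \<delta>"
          if "cmod \<zeta> = 1" "cmod (\<zeta> * cis s - w) \<le> \<delta> / c" "\<bar>s - s'\<bar> \<le> K * (K1 * \<delta>)"
            "\<And>z w. \<bar>co z - co w\<bar> \<le> cmod (z - w)" for co :: "complex \<Rightarrow> real" and w \<zeta> s s'
        proof -
          have "\<bar>co w - co (\<zeta> * cis s')\<bar> \<le> cmod (w - \<zeta> * cis s')"
            by (rule that(4))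
          also have "\<dots> = cmod ((w - \<zeta> * cis s) + \<zeta> * (cis s - cis s'))"
            by (simp add: algebra_simps)
          also have "\<dots> \<le> cmod (w - \<zeta> * cis s) + cmod (\<zeta> * (cis s - cis s'))"
            by (rule norm_triangle_ineq)
          also have "\<dots> \<le> \<delta> / c + K * (K1 * \<delta>)"
            using that(1,2,3) norm_cis_diff_le[of s s']
            by (intro add_mono) (auto simp: norm_mult norm_minus_commute)
          also have "\<dots> = R * \<delta>"
            by (simp add: R_def algebra_simps)
          finally show ?thesis .
        qed
        have "z \<in> W t"
          unfolding W_def z_eq B_def
          using lt1 depth2[OF lt1(1) depth(1)] depth2[OF lt1(2) depth(2)] U_co(3,4)[OF zU]
            co_near[OF \<xi>(1) rad1 t(2) co1(3)] co_near[OF \<xi>(2) rad2 t(3) co2(3)]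
          by (simp add: z1_def z2_def mem_Times_iff)
        with t show "z \<in> (\<Union>t\<in>T. W t)"
          by blast
      qed
      have e: "2 / c * \<delta> > 0" "R * \<delta> \<ge> 0"
        using hopf \<delta> R by auto
      have W_sets: "W t \<in> sets (V_beta \<beta>)" for t
        unfolding W_def by (intro V_B \<beta> co1 co2 e)
      have "emeasure (V_beta \<beta>) E \<le> emeasure (V_beta \<beta>) (\<Union>t\<in>T. W t)"
        using \<open>E \<subseteq> _\<close> W_sets T(1) by (intro emeasure_mono) auto
      also have "\<dots> \<le> (\<Sum>t\<in>T. emeasure (V_beta \<beta>) (W t))"
        using W_sets T(1) by (intro emeasure_subadditive_finite) auto
      also have "\<dots> \<le> (\<Sum>t\<in>T. ennreal ((8 * (R * \<delta>) * (2 / c * \<delta>) powr (\<beta> + 1))\<^sup>2))"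
        unfolding W_def by (intro sum_mono V_B \<beta> co1 co2 e)
      also have "\<dots> = ennreal (real (card T) * (8 * (R * \<delta>) * (2 / c * \<delta>) powr (\<beta> + 1))\<^sup>2)"
        by (simp add: ennreal_mult ennreal_of_nat_eq_real_of_nat)
      also have "\<dots> \<le> ennreal (C * \<delta> powr (2 + \<beta> + 1/2))"
      proof (rule ennreal_leI)
        have "real (card T) \<le> K / sqrt (K1 * \<delta>)"
          by (rule T)
        also have "\<dots> \<le> K / sqrt \<delta>"
          using K1 \<delta> cover(2) by (intro divide_left_mono) auto
        also have "\<dots> = K * \<delta> powr (-1/2)"
          using \<delta> by (simp add: powr_minus_divide powr_half_sqrt)
        finally have card: "real (card T) \<le> K * \<delta> powr (-1/2)" .
        have "(2 / c) powr (\<beta> + 1) \<le> m powr (\<beta> + 1)"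
          using \<beta> hopf by (intro powr_mono2) (auto simp: m_def)
        also have "\<dots> \<le> m powr 1"
          using \<beta> by (intro powr_mono) (auto simp: m_def)
        finally have m: "(2 / c) powr (\<beta> + 1) \<le> m"
          by (simp add: m_def)
        have "(2 / c * \<delta>) powr (\<beta> + 1) = (2 / c) powr (\<beta> + 1) * \<delta> powr (\<beta> + 1)"
          using hopf \<delta> by (subst powr_mult) auto
        also have "\<dots> \<le> m * \<delta> powr (\<beta> + 1)"
          using m by (intro mult_right_mono) auto
        finally have "8 * (R * \<delta>) * (2 / c * \<delta>) powr (\<beta> + 1) \<le> 8 * (R * \<delta>) * (m * \<delta> powr (\<beta> + 1))"
          using R \<delta> by (intro mult_left_mono) auto
        then have "(8 * (R * \<delta>) * (2 / c * \<delta>) powr (\<beta> + 1))\<^sup>2 \<le> (8 * (R * \<delta>) * (m * \<delta> powr (\<beta> + 1)))\<^sup>2"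
          using R \<delta> by (intro power_mono) auto
        with card have "real (card T) * (8 * (R * \<delta>) * (2 / c * \<delta>) powr (\<beta> + 1))\<^sup>2
            \<le> (K * \<delta> powr (-1/2)) * (8 * (R * \<delta>) * (m * \<delta> powr (\<beta> + 1)))\<^sup>2"
          using cover(2) by (intro mult_mono) auto
        also have "\<dots> = 64 * K * R\<^sup>2 * m\<^sup>2 * (\<delta> powr (-1/2) * (\<delta> powr 1 * \<delta> powr 1 * (\<delta> powr (\<beta> + 1) * \<delta> powr (\<beta> + 1))))"
          using \<delta> by (simp add: power2_eq_square algebra_simps)
        also have "\<dots> = 64 * K * R\<^sup>2 * m\<^sup>2 * \<delta> powr (2 + \<beta> + 1/2 + (\<beta> + 1))"
          by (simp only: powr_add[symmetric]) (simp add: algebra_simps)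
        \<comment> \<open>The exponent is -1/2 from the count, 2 from the widths and 2 (\<beta> + 1)
          from the depths. The surplus \<beta> + 1 over the target is positive and is given away, as
          \<delta> \<le> 1.\<close>
        also have "\<dots> \<le> 64 * K * R\<^sup>2 * m\<^sup>2 * \<delta> powr (2 + \<beta> + 1/2)"
        proof (intro mult_left_mono)
          have "1 * \<delta> \<le> K1 * \<delta>"
            using K1 \<delta> by (intro mult_right_mono) auto
          then have "\<delta> \<le> 1"
            using True by simp
          then show "\<delta> powr (2 + \<beta> + 1/2 + (\<beta> + 1)) \<le> \<delta> powr (2 + \<beta> + 1/2)"
            using \<delta> \<beta> by (intro powr_mono') auto
        qed (use cover(2) in auto)
        also have "\<dots> \<le> C * \<delta> powr (2 + \<beta> + 1/2)"
          by (intro mult_right_mono C) auto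
        finally show "real (card T) * (8 * (R * \<delta>) * (2 / c * \<delta>) powr (\<beta> + 1))\<^sup>2 \<le> C * \<delta> powr (2 + \<beta> + 1/2)" .
      qed
      finally show ?thesis
        by (simp add: E_def)
    qed
  qed
  show ?thesis
  proof (intro exI conjI ballI allI impI)
    show "open U" "(\<xi>1, \<xi>2) \<in> U" "C > 0"
      using r C by (auto simp: U_def)
  qed (use bound in auto)
qed

subsection \<open>Derivatives at the boundary point\<close>

text \<open>Holomorphy is available only inside, so complex linearity is carried to the boundary by
  continuity along r x as r -> 1. It will turn the derivative along the torus into i times the
  radial derivative.\<close>

lemma frechet_derivative_complex_linear_closed_bidisc:
  fixes \<phi> :: "complex \<times> complex \<Rightarrow> complex"
  assumes hol: "holomorphic2_on \<phi> bidisc"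
    and cont: "\<And>v. continuous_on closed_bidisc (\<lambda>x. frechet_derivative \<phi> (at x) v)"
    and x: "x \<in> closed_bidisc"
  shows "frechet_derivative \<phi> (at x) (\<i> * v, \<i> * w) = \<i> * frechet_derivative \<phi> (at x) (v, w)"
proof -
  have interior: "frechet_derivative \<phi> (at y) (\<i> * v, \<i> * w) = \<i> * frechet_derivative \<phi> (at y) (v, w)"
    if y: "y \<in> bidisc" for y
  proof -
    obtain c1 c2 where "(\<phi> has_derivative (\<lambda>h. c1 * fst h + c2 * snd h)) (at y)"
      using hol y unfolding holomorphic2_on_def by blast
    then have "frechet_derivative \<phi> (at y) = (\<lambda>h. c1 * fst h + c2 * snd h)"
      by (rule frechet_derivative_at[symmetric])
    then show ?thesis
      by (simp add: algebra_simps)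
  qed
  have radial: "((\<lambda>r. frechet_derivative \<phi> (at (r *\<^sub>R x)) u) \<longlongrightarrow> frechet_derivative \<phi> (at x) u) (at_left 1)" for u
  proof -
    have "continuous_on {0..1} (\<lambda>r. frechet_derivative \<phi> (at (r *\<^sub>R x)) u)"
      by (rule continuous_on_compose2[OF cont])
        (use x in \<open>auto intro!: continuous_intros mult_le_one simp: closed_bidisc_def\<close>)
    then have "((\<lambda>r. frechet_derivative \<phi> (at (r *\<^sub>R x)) u) \<longlongrightarrow> frechet_derivative \<phi> (at (1 *\<^sub>R x)) u) (at 1 within {0..1})"
      unfolding continuous_on by (metis atLeastAtMost_iff order_refl zero_le_one)
    then show ?thesis
      by (simp add: at_within_Icc_at_left)
  qed
  show ?thesis
  proof (rule tendsto_unique)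
    show "((\<lambda>r. frechet_derivative \<phi> (at (r *\<^sub>R x)) (\<i> * v, \<i> * w))
        \<longlongrightarrow> frechet_derivative \<phi> (at x) (\<i> * v, \<i> * w)) (at_left 1)"
      by (rule radial)
    have "((\<lambda>r. \<i> * frechet_derivative \<phi> (at (r *\<^sub>R x)) (v, w))
        \<longlongrightarrow> \<i> * frechet_derivative \<phi> (at x) (v, w)) (at_left 1)"
      by (intro tendsto_intros radial)
    then show "((\<lambda>r. frechet_derivative \<phi> (at (r *\<^sub>R x)) (\<i> * v, \<i> * w))
        \<longlongrightarrow> \<i> * frechet_derivative \<phi> (at x) (v, w)) (at_left 1)"
    proof (rule Lim_transform_eventually)
      show "\<forall>\<^sub>F r in at_left 1. \<i> * frechet_derivative \<phi> (at (r *\<^sub>R x)) (v, w)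
          = frechet_derivative \<phi> (at (r *\<^sub>R x)) (\<i> * v, \<i> * w)"
        using eventually_at_left_real[of 0 1]
      proof (rule eventually_mono)
        fix r :: real
        assume r: "r \<in> {0<..<1}"
        have "r * cmod y < 1" if "cmod y \<le> 1" for y
        proof -
          have "r * cmod y \<le> r * 1"
            using r that by (intro mult_left_mono) auto
          also have "\<dots> < 1"
            using r by simp
          finally show ?thesis .
        qed
        then have "r *\<^sub>R x \<in> bidisc"
          using x r by (auto simp: bidisc_def closed_bidisc_def)
        then show "\<i> * frechet_derivative \<phi> (at (r *\<^sub>R x)) (v, w)
          = frechet_derivative \<phi> (at (r *\<^sub>R x)) (\<i> * v, \<i> * w)"
          by (rule interior[symmetric])
      qed simp
    qed
  qed simp
qed

lemma holomorphic2_on_slices: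
  assumes "holomorphic2_on \<phi> bidisc" and w: "w \<in> ball 0 1"
  shows "(\<lambda>z. \<phi> (z, w)) holomorphic_on ball 0 1" and "(\<lambda>z. \<phi> (w, z)) holomorphic_on ball 0 1"
proof -
  have deriv: "\<exists>c1 c2. (\<phi> has_derivative (\<lambda>h. c1 * fst h + c2 * snd h)) (at (z, z'))"
    if "z \<in> ball 0 1" "z' \<in> ball 0 1" for z z'
    using assms(1) that unfolding holomorphic2_on_def bidisc_def by blast
  show "(\<lambda>z. \<phi> (z, w)) holomorphic_on ball 0 1"
  proof (rule holomorphic_onI)
    fix z :: complex
    assume "z \<in> ball 0 1"
    then obtain c1 c2 where d: "(\<phi> has_derivative (\<lambda>h. c1 * fst h + c2 * snd h)) (at (z, w))"
      using deriv w by blast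
    have "((\<lambda>z. (z, w)) has_derivative (\<lambda>h. (h, 0))) (at z)"
      by (intro has_derivative_Pair has_derivative_ident has_derivative_const)
    from has_derivative_compose[OF this d] have "((\<lambda>z. \<phi> (z, w)) has_derivative (\<lambda>h. c1 * h)) (at z)"
      by simp
    then have "((\<lambda>z. \<phi> (z, w)) has_field_derivative c1) (at z)"
      by (simp add: has_field_derivative_def)
    then show "(\<lambda>z. \<phi> (z, w)) field_differentiable at z within ball 0 1"
      using field_differentiable_at_within field_differentiable_def by blast
  qed
  show "(\<lambda>z. \<phi> (w, z)) holomorphic_on ball 0 1"
  proof (rule holomorphic_onI)
    fix z :: complex
    assume "z \<in> ball 0 1"
    then obtain c1 c2 where d: "(\<phi> has_derivative (\<lambda>h. c1 * fst h + c2 * snd h)) (at (w, z))"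
      using deriv w by blast
    have "((\<lambda>z. (w, z)) has_derivative (\<lambda>h. (0, h))) (at z)"
      by (intro has_derivative_Pair has_derivative_ident has_derivative_const)
    from has_derivative_compose[OF this d] have "((\<lambda>z. \<phi> (w, z)) has_derivative (\<lambda>h. c2 * h)) (at z)"
      by simp
    then have "((\<lambda>z. \<phi> (w, z)) has_field_derivative c2) (at z)"
      by (simp add: has_field_derivative_def)
    then show "(\<lambda>z. \<phi> (w, z)) field_differentiable at z within ball 0 1"
      using field_differentiable_at_within field_differentiable_def by blast
  qed
qed

text \<open>For t < 1, dividing by t - 1 reverses the inequality, so the left difference quotients
  stay above \<open>c\<close>.\<close>

lemma boundary_derivative_lower:
  fixes f :: "real \<Rightarrow> real"
  assumes deriv: "(f has_real_derivative d) (at 1)" and f1: "f 1 = 1"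
    and le: "\<And>t. 0 < t \<Longrightarrow> t < 1 \<Longrightarrow> f t \<le> 1 - c * (1 - t)"
  shows "c \<le> d"
proof (rule tendsto_lowerbound)
  have "((\<lambda>t. (f t - f 1) / (t - 1)) \<longlongrightarrow> d) (at 1)"
    using deriv by (simp add: has_field_derivative_iff)
  then show "((\<lambda>t. (f t - f 1) / (t - 1)) \<longlongrightarrow> d) (at_left 1)"
    by (rule filterlim_mono) (auto simp: at_within_le_at)
  show "\<forall>\<^sub>F t in at_left 1. c \<le> (f t - f 1) / (t - 1)"
    using eventually_at_left_real[of 0 1]
  proof (rule eventually_mono)
    fix t :: real
    assume "t \<in> {0<..<1}"
    then have t: "0 < t" "t < 1"
      by auto
    then show "c \<le> (f t - f 1) / (t - 1)"
      using le[OF t] f1 by (simp add: le_divide_eq_1_neg neg_le_divide_eq algebra_simps)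
  qed simp
qed simp

lemma hopf_bidisc:
  fixes \<phi> :: "complex \<times> complex \<Rightarrow> complex"
  assumes hol: "holomorphic2_on \<phi> bidisc" and im: "\<phi> ` bidisc \<subseteq> ball 0 1"
    and cont: "continuous_on closed_bidisc \<phi>" and \<xi>: "cmod \<xi>1 = 1" "cmod \<xi>2 = 1"
    and nonconst: "\<exists>t. \<phi> (\<xi>1 * cis t, \<xi>2) \<noteq> \<phi> (\<xi>1, \<xi>2)" "\<exists>t. \<phi> (\<xi>1, \<xi>2 * cis t) \<noteq> \<phi> (\<xi>1, \<xi>2)"
  obtains c \<rho> where "c > 0" "\<rho> > 0"
    "\<And>z w. z \<in> ball 0 1 \<Longrightarrow> w \<in> cball 0 1 \<Longrightarrow> dist w \<xi>2 < \<rho> \<Longrightarrow> c * (1 - cmod z) \<le> 1 - cmod (\<phi> (z, w))"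
    "\<And>z w. z \<in> cball 0 1 \<Longrightarrow> w \<in> ball 0 1 \<Longrightarrow> dist z \<xi>1 < \<rho> \<Longrightarrow> c * (1 - cmod w) \<le> 1 - cmod (\<phi> (z, w))"
proof -
  have im': "\<phi> (z, w) \<in> ball 0 1" if "z \<in> ball 0 1" "w \<in> ball 0 1" for z w
    using im that unfolding bidisc_def by blast
  have im'': "\<phi> (w, z) \<in> ball 0 1" if "z \<in> ball 0 1" "w \<in> ball 0 1" for z w
    by (rule im'[OF that(2,1)])
  have sphere: "\<xi>1 \<in> sphere 0 1" "\<xi>2 \<in> sphere 0 1"
    using \<xi> by auto
  obtain a1 where a1: "a1 \<in> cball 0 1" "\<phi> (a1, \<xi>2) \<noteq> \<phi> (0, \<xi>2)"
  proof -
    obtain t where "\<phi> (\<xi>1 * cis t, \<xi>2) \<noteq> \<phi> (\<xi>1, \<xi>2)"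
      using nonconst by blast
    \<comment> \<open>Two different values cannot both equal the value at the centre, so one of the
      two circle points serves as \<open>a1\<close>.\<close>
    then have "\<phi> (\<xi>1 * cis t, \<xi>2) \<noteq> \<phi> (0, \<xi>2) \<or> \<phi> (\<xi>1, \<xi>2) \<noteq> \<phi> (0, \<xi>2)"
      by auto
    then show ?thesis
      using that[of "\<xi>1 * cis t"] that[of \<xi>1] \<xi> by (auto simp: norm_mult)
  qed
  obtain a2 where a2: "a2 \<in> cball 0 1" "\<phi> (\<xi>1, a2) \<noteq> \<phi> (\<xi>1, 0)"
  proof -
    obtain t where "\<phi> (\<xi>1, \<xi>2 * cis t) \<noteq> \<phi> (\<xi>1, \<xi>2)"
      using nonconst by blast
    then have "\<phi> (\<xi>1, \<xi>2 * cis t) \<noteq> \<phi> (\<xi>1, 0) \<or> \<phi> (\<xi>1, \<xi>2) \<noteq> \<phi> (\<xi>1, 0)"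
      by auto
    then show ?thesis
      using that[of "\<xi>2 * cis t"] that[of \<xi>2] \<xi> by (auto simp: norm_mult)
  qed
  have cont1: "continuous_on (cball 0 1 \<times> cball 0 1) (\<lambda>(z, w). \<phi> (z, w))"
    using cont by (simp add: closed_bidisc_def)
  have cont2: "continuous_on (cball 0 1 \<times> cball 0 1) (\<lambda>(z, w). \<phi> (w, z))"
    unfolding case_prod_unfold
    by (rule continuous_on_compose2[OF cont]) (auto intro!: continuous_intros simp: closed_bidisc_def)
  obtain c1 \<rho>1 where 1: "c1 > 0" "\<rho>1 > 0"
    "\<And>z w. z \<in> ball 0 1 \<Longrightarrow> w \<in> cball 0 1 \<Longrightarrow> dist w \<xi>2 < \<rho>1 \<Longrightarrow> c1 * (1 - cmod z) \<le> 1 - cmod (\<phi> (z, w))"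
    by (rule hopf_bound[where g = "\<lambda>z w. \<phi> (z, w)", OF holomorphic2_on_slices(1)[OF hol] im' cont1 sphere(2) a1]) (assumption+, rule that)
  obtain c2 \<rho>2 where 2: "c2 > 0" "\<rho>2 > 0"
    "\<And>z w. z \<in> ball 0 1 \<Longrightarrow> w \<in> cball 0 1 \<Longrightarrow> dist w \<xi>1 < \<rho>2 \<Longrightarrow> c2 * (1 - cmod z) \<le> 1 - cmod (\<phi> (w, z))"
    by (rule hopf_bound[where g = "\<lambda>z w. \<phi> (w, z)", OF holomorphic2_on_slices(2)[OF hol] im'' cont2 sphere(1) a2]) (assumption+, rule that)
  show thesis
  proof
    show "min c1 c2 > 0" "min \<rho>1 \<rho>2 > 0"
      using 1 2 by auto
    have weaken: "min c1 c2 * (1 - cmod z) \<le> c * (1 - cmod z)" if "z \<in> ball 0 1" "c = c1 \<or> c = c2" for z c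
      using that by (intro mult_right_mono) auto
    show "min c1 c2 * (1 - cmod z) \<le> 1 - cmod (\<phi> (z, w))"
      if "z \<in> ball 0 1" "w \<in> cball 0 1" "dist w \<xi>2 < min \<rho>1 \<rho>2" for z w
      using order_trans[OF weaken[of z c1] 1(3)[of z w]] that by simp
    show "min c1 c2 * (1 - cmod w) \<le> 1 - cmod (\<phi> (z, w))"
      if "z \<in> cball 0 1" "w \<in> ball 0 1" "dist z \<xi>1 < min \<rho>1 \<rho>2" for z w
      using order_trans[OF weaken[of w c2] 2(3)[of w z]] that by simp
  qed
qed

text \<open>If \<open>F\<close> were constant on the line, the second-order quotient would vanish
  identically and its limit -Q(h) would be 0. With h = (1, 0) and h = (0, 1) this supplies the
  non-constant slices for the Hopf bound.\<close>

lemma nonconstant_along_line: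
  assumes o: "(\<lambda>\<theta>. Re (\<mu> * F \<theta>) - (1 - (a * (fst \<theta>)\<^sup>2 + 2 * b * fst \<theta> * snd \<theta> + c * (snd \<theta>)\<^sup>2))) \<in> o[at 0](\<lambda>\<theta>. (norm \<theta>)\<^sup>2)"
    and F0: "\<mu> * F 0 = 1" and h: "h \<noteq> 0"
    and pos: "a * (fst h)\<^sup>2 + 2 * b * fst h * snd h + c * (snd h)\<^sup>2 > 0"
  shows "\<exists>t. F (t *\<^sub>R h) \<noteq> F 0"
proof (rule ccontr)
  assume "\<not> ?thesis"
  then have "(\<lambda>t. (Re (\<mu> * F (t *\<^sub>R h)) - 1) / t\<^sup>2) = (\<lambda>t. 0)"
    using F0 by simp
  with expansion_along_line[OF o h]
  have "((\<lambda>t::real. 0::real) \<longlongrightarrow> - (a * (fst h)\<^sup>2 + 2 * b * fst h * snd h + c * (snd h)\<^sup>2)) (at 0)"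
    by simp
  with tendsto_const have "0 = - (a * (fst h)\<^sup>2 + 2 * b * fst h * snd h + c * (snd h)\<^sup>2)"
    by (rule LIM_unique)
  with pos show False
    by simp
qed

text \<open>The Hopf lemma at the boundary point: along the radius, Re(\<mu> \<phi>) \<le> |\<phi>|
  \<le> 1 - k (1 - t), with equality at t = 1, so the outward derivative of Re(\<mu> \<phi>) is at
  least \<open>k\<close>.\<close>

lemma normal_derivative_lower:
  fixes \<phi> :: "complex \<times> complex \<Rightarrow> complex"
  assumes diff: "\<phi> differentiable at (\<xi>1, \<xi>2)" and \<mu>: "\<mu> * \<phi> (\<xi>1, \<xi>2) = 1" "cmod \<mu> = 1"
    and le: "\<And>t. 0 < t \<Longrightarrow> t < 1 \<Longrightarrow> k * (1 - t) \<le> 1 - cmod (\<phi> (of_real t * \<xi>1, \<xi>2))"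
  shows "k \<le> Re (\<mu> * frechet_derivative \<phi> (at (\<xi>1, \<xi>2)) (\<xi>1, 0))"
proof (rule boundary_derivative_lower)
  let ?D = "frechet_derivative \<phi> (at (\<xi>1, \<xi>2))"
  have bl: "bounded_linear (\<lambda>w. Re (\<mu> * w))"
    by (rule bounded_linear_compose[OF bounded_linear_Re bounded_linear_mult_right])
  have "((\<lambda>t. (of_real t * \<xi>1, \<xi>2)) has_derivative (\<lambda>s. s *\<^sub>R (\<xi>1, 0))) (at 1)"
    by (auto intro!: derivative_eq_intros simp: scaleR_conv_of_real)
  moreover have "(\<phi> has_derivative ?D) (at (of_real 1 * \<xi>1, \<xi>2))"
    using diff by (simp add: frechet_derivative_works)
  ultimately have "((\<lambda>t. \<phi> (of_real t * \<xi>1, \<xi>2)) has_derivative (\<lambda>s. ?D (s *\<^sub>R (\<xi>1, 0)))) (at 1)"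
    by (rule has_derivative_compose)
  then have "((\<lambda>t. \<phi> (of_real t * \<xi>1, \<xi>2)) has_vector_derivative ?D (\<xi>1, 0)) (at 1)"
    unfolding has_vector_derivative_def by (simp only: linear_scale[OF linear_frechet_derivative[OF diff]])
  then show "((\<lambda>t. Re (\<mu> * \<phi> (of_real t * \<xi>1, \<xi>2))) has_real_derivative Re (\<mu> * ?D (\<xi>1, 0))) (at 1)"
    unfolding has_real_derivative_iff_has_vector_derivative
    by (rule bounded_linear.has_vector_derivative[OF bl])
  show "Re (\<mu> * \<phi> (of_real 1 * \<xi>1, \<xi>2)) = 1"
    using \<mu> by simp
  fix t :: real
  assume t: "0 < t" "t < 1"
  have "Re (\<mu> * \<phi> (of_real t * \<xi>1, \<xi>2)) \<le> cmod (\<mu> * \<phi> (of_real t * \<xi>1, \<xi>2))"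
    by (rule complex_Re_le_cmod)
  also have "\<dots> = cmod (\<phi> (of_real t * \<xi>1, \<xi>2))"
    by (simp add: norm_mult \<mu>)
  also have "\<dots> \<le> 1 - k * (1 - t)"
    using le[OF t] by simp
  finally show "Re (\<mu> * \<phi> (of_real t * \<xi>1, \<xi>2)) \<le> 1 - k * (1 - t)" .
qed

theorem mainTheorem14:
  fixes \<phi> :: "complex \<times> complex \<Rightarrow> complex" and \<xi> :: "complex \<times> complex"
  assumes "holomorphic2_on \<phi> bidisc"
    and "\<phi> ` bidisc \<subseteq> ball 0 1"
    and "Ck_on_closed_bidisc 3 \<phi>"
    and "\<xi> \<in> torus2" and "\<phi> \<xi> \<in> sphere 0 1"
    and "truly_two_dim_order2 \<phi> \<xi>"
  shows "\<exists>U C. open U \<and> \<xi> \<in> U \<and> C > 0 \<and>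
           (\<forall>\<beta>\<in>{-1<..0}. \<forall>\<eta>\<in>sphere (0::complex) 1. \<forall>\<delta>>0.
              emeasure (V_beta \<beta>) {z \<in> bidisc \<inter> U. cmod (\<phi> z - \<eta>) < \<delta>}
                \<le> ennreal (C * \<delta> powr (2 + \<beta> + 1/2)))"
proof -
  note hol = assms(1) and im = assms(2)
  obtain \<xi>1 \<xi>2 where \<xi>_eq: "\<xi> = (\<xi>1, \<xi>2)" and \<xi>: "cmod \<xi>1 = 1" "cmod \<xi>2 = 1"
    using assms(4) by (auto simp: torus2_def)
  define \<alpha>1 \<alpha>2 where "\<alpha>1 = Arg \<xi>1" and "\<alpha>2 = Arg \<xi>2"
  have "\<xi>1 \<noteq> 0" "\<xi>2 \<noteq> 0"
    using \<xi> by auto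
  then have \<alpha>: "\<xi>1 = cis \<alpha>1" "\<xi>2 = cis \<alpha>2"
    using \<xi> by (auto simp: \<alpha>1_def \<alpha>2_def cis_Arg sgn_div_norm)
  define \<mu> where "\<mu> = cnj (\<phi> \<xi>)"
  have \<mu>: "\<mu> * \<phi> \<xi> = 1" "cmod \<mu> = 1"
    using assms(5) by (auto simp: \<mu>_def mult.commute[of "cnj _"] simp flip: complex_norm_square)
  obtain S where S: "closed_bidisc \<subseteq> S" "Ck_on 3 S \<phi>"
    using assms(3) unfolding Ck_on_closed_bidisc_def by blast
  have diff: "\<phi> differentiable (at x)" if "x \<in> closed_bidisc" for x
    using S that unfolding numeral_3_eq_3 Ck_on.simps by blast
  have contD: "continuous_on closed_bidisc (\<lambda>x. frechet_derivative \<phi> (at x) v)" for v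
    using S unfolding numeral_3_eq_3 Ck_on.simps by (blast intro: continuous_on_subset)
  have cont: "continuous_on closed_bidisc \<phi>"
    using S unfolding numeral_3_eq_3 Ck_on.simps by (blast intro: continuous_on_subset)
  have torus_S: "torus2 \<subseteq> S"
    using S(1) by (auto simp: torus2_def closed_bidisc_def)
  obtain F1 F2 F11 F12 F21 F22 where
    hp: "has_partials (\<lambda>p. \<phi> (cis (\<alpha>1 + fst p), cis (\<alpha>2 + snd p))) F1 F2" "has_partials F1 F11 F12" "has_partials F2 F21 F22"
    and contF: "continuous_on UNIV F11" "continuous_on UNIV F12" "continuous_on UNIV F21" "continuous_on UNIV F22"
    and F1: "\<And>p. F1 p = frechet_derivative \<phi> (at (cis (\<alpha>1 + fst p), cis (\<alpha>2 + snd p))) (\<i> * cis (\<alpha>1 + fst p), 0)"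
    by (rule torus_C2[OF torus_S S(2), of \<alpha>1 \<alpha>2]) (rule that)
  define F where "F p = \<phi> (\<xi>1 * cis (fst p), \<xi>2 * cis (snd p))" for p
  have hpF: "has_partials F F1 F2"
    using hp(1) by (simp add: F_def[abs_def] \<alpha> cis_mult)
  have F0: "\<mu> * F 0 = 1"
    using \<mu> by (simp add: F_def \<xi>_eq)
  obtain a b c where pos: "\<And>\<theta>::real\<times>real. \<theta> \<noteq> 0 \<Longrightarrow> a * (fst \<theta>)\<^sup>2 + 2 * b * fst \<theta> * snd \<theta> + c * (snd \<theta>)\<^sup>2 > 0"
    and "(\<lambda>\<theta>::real\<times>real. Re (psi_at \<phi> \<xi> \<theta>) - (1 - (a * (fst \<theta>)\<^sup>2 + 2 * b * fst \<theta> * snd \<theta> + c * (snd \<theta>)\<^sup>2)))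
          \<in> o[at 0](\<lambda>\<theta>. (norm \<theta>)\<^sup>2)"
    using assms(6) unfolding truly_two_dim_order2_def by blast
  then have o: "(\<lambda>\<theta>. Re (\<mu> * F \<theta>) - (1 - (a * (fst \<theta>)\<^sup>2 + 2 * b * fst \<theta> * snd \<theta> + c * (snd \<theta>)\<^sup>2)))
          \<in> o[at 0](\<lambda>\<theta>. (norm \<theta>)\<^sup>2)"
    by (simp add: psi_at_def F_def \<mu>_def \<xi>_eq)

  note nonconst = nonconstant_along_line[OF o F0 _ pos]
  have nonconst12: "\<exists>t. \<phi> (\<xi>1 * cis t, \<xi>2) \<noteq> \<phi> (\<xi>1, \<xi>2)" "\<exists>t. \<phi> (\<xi>1, \<xi>2 * cis t) \<noteq> \<phi> (\<xi>1, \<xi>2)"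
    using nonconst[of "(1, 0)"] nonconst[of "(0, 1)"] by (auto simp: F_def zero_prod_def)
  obtain k \<rho> where k: "k > 0" "\<rho> > 0"
    and hopf1: "\<And>z w. z \<in> ball 0 1 \<Longrightarrow> w \<in> cball 0 1 \<Longrightarrow> dist w \<xi>2 < \<rho> \<Longrightarrow> k * (1 - cmod z) \<le> 1 - cmod (\<phi> (z, w))"
    and hopf2: "\<And>z w. z \<in> cball 0 1 \<Longrightarrow> w \<in> ball 0 1 \<Longrightarrow> dist z \<xi>1 < \<rho> \<Longrightarrow> k * (1 - cmod w) \<le> 1 - cmod (\<phi> (z, w))"
    by (rule hopf_bidisc[OF hol im cont \<xi> nonconst12]) (rule that)

  define A where "A = frechet_derivative \<phi> (at \<xi>) (\<xi>1, 0)"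
  have \<xi>cl: "\<xi> \<in> closed_bidisc"
    using \<xi> by (simp add: \<xi>_eq closed_bidisc_def)
  have F1_0: "F1 0 = \<i> * A"
    using frechet_derivative_complex_linear_closed_bidisc[OF hol contD \<xi>cl, of \<xi>1 0]
    by (simp add: F1 A_def \<xi>_eq flip: \<alpha>)
  have Re_A: "k \<le> Re (\<mu> * A)"
    unfolding A_def \<xi>_eq
  proof (rule normal_derivative_lower)
    show "\<phi> differentiable at (\<xi>1, \<xi>2)" "\<mu> * \<phi> (\<xi>1, \<xi>2) = 1" "cmod \<mu> = 1"
      using diff[OF \<xi>cl] \<mu> by (simp_all add: \<xi>_eq)
    show "k * (1 - t) \<le> 1 - cmod (\<phi> (of_real t * \<xi>1, \<xi>2))" if "0 < t" "t < 1" for t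
      using hopf1[of "of_real t * \<xi>1" \<xi>2] that \<xi> k by (simp add: norm_mult)
  qed
  define s where "s = Re (\<mu> * A)"
  have s: "s > 0"
    using Re_A k by (simp add: s_def)
  \<comment> \<open>The expansion of Re psi has no linear term. As \<open>F1 0 = \<i> * A\<close>,
    this says Im(\<mu> A) = 0, so \<mu> A is the positive real number \<open>s\<close>.\<close>
  have "Re (\<mu> * F1 0) = 0"
    using hessian_from_expansion(1)[OF hpF hp(2,3) o F0, of "(1, 0)"] by (simp add: zero_prod_def)
  then have \<mu>A: "\<mu> * A = of_real s"
    by (simp add: F1_0 s_def complex_eq_iff)
  \<comment> \<open>The functional that the planar cover uses at 0 is thereby s > 0 times w |->
    Re(\<mu> w), so its Hessian along \<open>F\<close> is -2 s Q, which gives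
    \<open>neg\<close>.\<close>
  have F1_\<mu>: "\<i> * cnj (F1 0) = of_real s * \<mu>"
  proof -
    have "A = of_real s * \<phi> \<xi>"
    proof -
      have "A = (\<mu> * \<phi> \<xi>) * A"
        by (simp add: \<mu>)
      also have "\<dots> = (\<mu> * A) * \<phi> \<xi>"
        by (simp add: mult_ac)
      finally show ?thesis
        by (simp add: \<mu>A)
    qed
    then show ?thesis
      by (simp add: F1_0 \<mu>_def)
  qed
  have F1_nz: "F1 0 \<noteq> 0"
    using \<mu>A s by (auto simp: F1_0)
  have neg: "Re (\<i> * cnj (F1 0) * (fst h *\<^sub>R (fst h *\<^sub>R F11 0 + snd h *\<^sub>R F12 0)
      + snd h *\<^sub>R (fst h *\<^sub>R F21 0 + snd h *\<^sub>R F22 0))) < 0" (is "Re (_ * ?H) < 0")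
    if "norm h = 1" for h
  proof -
    have h: "h \<noteq> 0"
      using that by auto
    have Re_s: "Re (of_real s * w) = s * Re w" for w
      by simp
    have "Re (\<i> * cnj (F1 0) * ?H) = s * Re (\<mu> * ?H)"
      unfolding F1_\<mu> mult.assoc by (rule Re_s)
    also have "\<dots> < 0"
      unfolding hessian_from_expansion(2)[OF hpF hp(2,3) o F0 h]
      using s pos[OF h] by (simp add: mult_less_0_iff)
    finally show ?thesis .
  qed
  obtain \<epsilon> K where cover: "\<epsilon> > 0" "K > 0"
    "\<And>\<eta> \<delta>. 0 < \<delta> \<Longrightarrow> \<delta> \<le> 1 \<Longrightarrow> \<exists>T. finite T \<and> real (card T) \<le> K / sqrt \<delta> \<and>
       (\<forall>p. norm p < \<epsilon> \<longrightarrow> cmod (F p - \<eta>) < \<delta> \<longrightarrow>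
         (\<exists>t\<in>T. \<bar>fst p - fst t\<bar> \<le> K * \<delta> \<and> \<bar>snd p - snd t\<bar> \<le> K * \<delta>))"
    by (rule planar_sublevel_cover[OF hpF hp(2,3) contF F1_nz neg]) (assumption, rule that)
  obtain L where L: "L > 0"
    "\<And>x y. x \<in> closed_bidisc \<Longrightarrow> y \<in> closed_bidisc \<Longrightarrow> cmod (\<phi> x - \<phi> y) \<le> L * norm (x - y)"
    by (rule C1_imp_lipschitz_on_closed_bidisc[OF diff contD]) (assumption, rule that)
  have hopf: "k * (1 - cmod (fst z)) \<le> 1 - cmod (\<phi> z) \<and> k * (1 - cmod (snd z)) \<le> 1 - cmod (\<phi> z)"
    if "z \<in> bidisc" "dist z (\<xi>1, \<xi>2) < \<rho>" for z
    using that hopf1[of "fst z" "snd z"] hopf2[of "fst z" "snd z"]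
      dist_fst_le[of z "(\<xi>1, \<xi>2)"] dist_snd_le[of z "(\<xi>1, \<xi>2)"]
    by (auto simp: bidisc_def)
  show ?thesis
    unfolding \<xi>_eq
    by (rule sublevel_measure_bound[OF \<xi> L k hopf cover(1,2) cover(3)[unfolded F_def]])
qed

end
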